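(* Let $f,g:\mathbb{R}^n\times\mathbb{R}^m\to\mathbb{R}^n$, with $f$ locally Lipschitz with respect to its first argument and $f(0,0)=g(0,0)=0$. Consider the impulsive system $$\dot x(t)=f(x(t),u(t)),\ t\in[t_0,\infty)\setminus T,\qquad x(t)=g(x^-(t),u^-(t)),\ t\in T. \qquad (\ast)$$ Let $V$ be an exponential ISS-Lyapunov function for $(\ast)$ with rate coefficients $c\in\mathbb{R}$ and $d\neq0$. Let $h:\mathbb{R}_+\to(0,\infty)$ be an arbitrary function for which there exists $\ell\in\mathcal{L}$ with $h(x)\le\ell(x)$ for all $x\in\mathbb{R}_+$, and let $\mathcal{S}[h]$ be the class of impulse time sequences $T$ satisfying the generalized average dwell-time (gADT) condition $$-d\,N(t,s)-c(t-s)\le\ln h(t-s)\qquad\text{for all } t\ge s\ge t_0,$$ where $N(t,s)$ is the number of jumps (impulse times of $T$) within the time-span $(s,t]$. Then $(\ast)$ is uniformly ISS over $\mathcal{S}[h]$.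
   Context: Notation: $\mathbb{R}_+=[0,\infty)$, and $|\cdot|$ is the Euclidean norm. Function classes: - $\mathcal{P}$: continuous $\gamma:\mathbb{R}_+\to\mathbb{R}_+$ with $\gamma(0)=0$ and $\gamma(r)>0$ for $r>0$. - $\mathcal{K}$: strictly increasing $\gamma\in\mathcal{P}$. - $\mathcal{K}_\infty$: unbounded $\gamma\in\mathcal{K}$. - $\mathcal{L}$: continuous strictly decreasing $\gamma:\mathbb{R}_+\to\mathbb{R}_+$ with $\lim_{t\to\infty}\gamma(t)=0$. - $\mathcal{KL}$: functions $\beta:\mathbb{R}_+\times\mathbb{R}_+\to\mathbb{R}_+$ with $\beta(\cdot,t)\in\mathcal{K}$ for all $t\ge0$ and $\beta(r,\cdot)\in\mathcal{L}$ for all $r>0$. Impulsive system: $T=\{t_1,t_2,t_3,\dots\}$ is a monotonically increasing sequence of impulse times without finite accumulation points. Admissible inputs are functions $u\in L_\infty([t_0,\infty),\mathbb{R}^m)$ that are right-continuous and possess left limits $u^-(t)=\lim_{s\to t-0}u(s)$ at all times; $\|u\|_\infty$ is the supremum norm. Solutions $x:[t_0,\infty)\to\mathbb{R}^n$ start at $x(t_0)=x_0$, are absolutely continuous between impulses, are right-continuous, and have left limits $x^-(t)=\lim_{s\to t-0}x(s)$. The local Lipschitz assumption on $f$ is made in order to guarantee existence and uniqueness of solutions. ISS: for a given sequence $T$, the system is input-to-state stable (ISS) if there exist $\beta\in\mathcal{KL}$ and $\gamma\in\mathcal{K}_\infty$ such that for all initial conditions $x_0$, all admissible inputs $u$ and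 all $t\ge t_0$, $$|x(t)|\le\max\{\beta(|x_0|,t-t_0),\gamma(\|u\|_\infty)\}.$$ The system is uniformly ISS over a set $\mathcal{S}$ of admissible sequences of impulse times if it is ISS for every sequence in $\mathcal{S}$, with $\beta$ and $\gamma$ independent of the choice of the sequence from $\mathcal{S}$. Exponential ISS-Lyapunov function: a smooth function $V:\mathbb{R}^n\to\mathbb{R}_+$ is an exponential ISS-Lyapunov function with rate coefficients $c,d\in\mathbb{R}$ for the system if there exist $\psi_1,\psi_2\in\mathcal{K}_\infty$ with $\psi_1(|x|)\le V(x)\le\psi_2(|x|)$ for all $x\in\mathbb{R}^n$, and there exists $\chi\in\mathcal{K}_\infty$ such that for all $x\in\mathbb{R}^n$, $u\in\mathbb{R}^m$: if $V(x)\ge\chi(|u|)$, then both $\dot V(x)=\nabla V(x)\cdot f(x,u)\le-c\,V(x)$ and $V(g(x,u))\le e^{-d}V(x)$.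
   Formalization: The jump map g is assumed in addition to map bounded sets to bounded sets and to be continuous at (0,0); without this the claim fails, since nothing restricts g(x,u) where V(x) < χ(|u|). *)

theory Defs
  imports "HOL-Analysis.Analysis"
begin

(* Comparison functions are total functions real => real; only their restriction to {0..} matters. *)

definition class_P :: "(real \<Rightarrow> real) \<Rightarrow> bool" where
  "class_P \<gamma> \<longleftrightarrow> continuous_on {0..} \<gamma> \<and> \<gamma> 0 = 0 \<and> (\<forall>r>0. \<gamma> r > 0)"

definition class_K :: "(real \<Rightarrow> real) \<Rightarrow> bool" where
  "class_K \<gamma> \<longleftrightarrow> class_P \<gamma> \<and> strict_mono_on {0..} \<gamma>"

definition class_K_inf :: "(real \<Rightarrow> real) \<Rightarrow> bool" where
  "class_K_inf \<gamma> \<longleftrightarrow> class_K \<gamma> \<and> \<not> bdd_above (\<gamma> ` {0..})"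

definition class_L :: "(real \<Rightarrow> real) \<Rightarrow> bool" where
  "class_L \<gamma> \<longleftrightarrow> continuous_on {0..} \<gamma> \<and> (\<forall>t\<ge>0. \<gamma> t \<ge> 0) \<and>
     strict_antimono_on {0..} \<gamma> \<and> (\<gamma> \<longlongrightarrow> 0) at_top"

definition class_KL :: "(real \<Rightarrow> real \<Rightarrow> real) \<Rightarrow> bool" where
  "class_KL \<beta> \<longleftrightarrow> (\<forall>t\<ge>0. class_K (\<lambda>r. \<beta> r t)) \<and> (\<forall>r>0. class_L (\<beta> r))"

primrec C_k :: "nat \<Rightarrow> (real ^ 'n \<Rightarrow> real) \<Rightarrow> bool" where
  "C_k 0 = (\<lambda>V. continuous_on UNIV V)"
| "C_k (Suc k) = (\<lambda>V. \<exists>G. (\<forall>x. GDERIV V x :> G x) \<and> (\<forall>i. C_k k (\<lambda>x. G x $ i)))"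

definition smooth :: "(real ^ 'n \<Rightarrow> real) \<Rightarrow> bool" where
  "smooth V \<longleftrightarrow> (\<forall>k. C_k k V)"

definition gradient :: "('a::real_inner \<Rightarrow> real) \<Rightarrow> 'a \<Rightarrow> 'a" where
  "gradient V x = (THE D. GDERIV V x :> D)"

(* The Lipschitz constant may depend on u. *)
definition locally_lipschitz_fst ::
  "(real ^ 'n \<Rightarrow> real ^ 'm \<Rightarrow> real ^ 'n) \<Rightarrow> bool" where
  "locally_lipschitz_fst f \<longleftrightarrow>
     (\<forall>u x. \<exists>\<epsilon>>0. \<exists>L. L-lipschitz_on (cball x \<epsilon>) (\<lambda>y. f y u))"

definition impulse_times :: "real \<Rightarrow> (nat \<Rightarrow> real) \<Rightarrow> bool" where
  "impulse_times t0 T \<longleftrightarrow> strict_mono T \<and> (\<forall>k. t0 < T k) \<and> (\<forall>p. \<not> p islimpt range T)"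

definition num_jumps :: "(nat \<Rightarrow> real) \<Rightarrow> real \<Rightarrow> real \<Rightarrow> nat" where
  "num_jumps T t s = card (range T \<inter> {s<..t})"

definition gADT_class :: "real \<Rightarrow> real \<Rightarrow> real \<Rightarrow> (real \<Rightarrow> real) \<Rightarrow> (nat \<Rightarrow> real) set" where
  "gADT_class t0 c d h = {T. impulse_times t0 T \<and>
     (\<forall>s t. t0 \<le> s \<and> s \<le> t \<longrightarrow>
        - d * real (num_jumps T t s) - c * (t - s) \<le> ln (h (t - s)))}"

(* For right-continuous functions essential boundedness and boundedness coincide, and such
   functions with left limits are Borel measurable. *)
definition admissible_input :: "real \<Rightarrow> (real \<Rightarrow> real ^ 'm) \<Rightarrow> bool" where
  "admissible_input t0 u \<longleftrightarrow> bounded (u ` {t0..}) \<and>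
     (\<forall>t\<ge>t0. continuous (at_right t) u) \<and> (\<forall>t>t0. \<exists>l. (u \<longlongrightarrow> l) (at_left t))"

definition sup_norm :: "real \<Rightarrow> (real \<Rightarrow> real ^ 'm) \<Rightarrow> real" where
  "sup_norm t0 u = (SUP t\<in>{t0..}. norm (u t))"

(* The usual epsilon-delta definition: a division consists of finitely many non-overlapping
   compact intervals. *)
definition abs_continuous_on :: "real set \<Rightarrow> (real \<Rightarrow> 'a::real_normed_vector) \<Rightarrow> bool" where
  "abs_continuous_on S x \<longleftrightarrow>
     (\<forall>\<epsilon>>0. \<exists>\<delta>>0. \<forall>D A. D division_of A \<and> A \<subseteq> S \<and> (\<Sum>K\<in>D. Sup K - Inf K) < \<delta> \<longrightarrow>
        (\<Sum>K\<in>D. norm (x (Sup K) - x (Inf K))) < \<epsilon>)"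

(* x is a solution on the interval J with left end point t0.  Absolute continuity between impulses
   is required on compact intervals [a, b] with no impulse in (a, b]; the differential equation is
   understood in the sense of Caratheodory, i.e. almost everywhere. *)
definition is_solution ::
  "(real ^ 'n \<Rightarrow> real ^ 'm \<Rightarrow> real ^ 'n) \<Rightarrow> (real ^ 'n \<Rightarrow> real ^ 'm \<Rightarrow> real ^ 'n) \<Rightarrow> real \<Rightarrow>
   (nat \<Rightarrow> real) \<Rightarrow> (real \<Rightarrow> real ^ 'm) \<Rightarrow> real ^ 'n \<Rightarrow> real set \<Rightarrow> (real \<Rightarrow> real ^ 'n) \<Rightarrow> bool" where
  "is_solution f g t0 T u x0 J x \<longleftrightarrow>
     x t0 = x0 \<and>
     (\<forall>t\<in>J. continuous (at_right t) x) \<and>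
     (\<forall>t\<in>J. t > t0 \<longrightarrow> (\<exists>l. (x \<longlongrightarrow> l) (at_left t))) \<and>
     (\<forall>a b. a \<le> b \<and> {a..b} \<subseteq> J \<and> range T \<inter> {a<..b} = {} \<longrightarrow> abs_continuous_on {a..b} x) \<and>
     (AE t in lebesgue. t \<in> J - range T \<longrightarrow> (x has_vector_derivative f (x t) (u t)) (at t)) \<and>
     (\<forall>t \<in> J \<inter> range T. x t = g (Lim (at_left t) x) (Lim (at_left t) u))"

(* Global solutions correspond to J = [t0, \<infinity>).  Bounded intervals [t0, \<tau>) are admitted as well, so
   that a solution with finite escape time does not satisfy the estimate vacuously. *)
definition ISS_estimate ::
  "(real ^ 'n \<Rightarrow> real ^ 'm \<Rightarrow> real ^ 'n) \<Rightarrow> (real ^ 'n \<Rightarrow> real ^ 'm \<Rightarrow> real ^ 'n) \<Rightarrow> real \<Rightarrow>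
   (nat \<Rightarrow> real) \<Rightarrow> (real \<Rightarrow> real \<Rightarrow> real) \<Rightarrow> (real \<Rightarrow> real) \<Rightarrow> bool" where
  "ISS_estimate f g t0 T \<beta> \<gamma> \<longleftrightarrow>
     (\<forall>x0 u J x. admissible_input t0 u \<and> (J = {t0..} \<or> (\<exists>\<tau>>t0. J = {t0..<\<tau>})) \<and>
        is_solution f g t0 T u x0 J x \<longrightarrow>
        (\<forall>t\<in>J. norm (x t) \<le> max (\<beta> (norm x0) (t - t0)) (\<gamma> (sup_norm t0 u))))"

definition uniformly_ISS ::
  "(real ^ 'n \<Rightarrow> real ^ 'm \<Rightarrow> real ^ 'n) \<Rightarrow> (real ^ 'n \<Rightarrow> real ^ 'm \<Rightarrow> real ^ 'n) \<Rightarrow> real \<Rightarrow>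
   (nat \<Rightarrow> real) set \<Rightarrow> bool" where
  "uniformly_ISS f g t0 S \<longleftrightarrow>
     (\<exists>\<beta> \<gamma>. class_KL \<beta> \<and> class_K_inf \<gamma> \<and> (\<forall>T\<in>S. ISS_estimate f g t0 T \<beta> \<gamma>))"

definition exp_ISS_Lyapunov ::
  "(real ^ 'n \<Rightarrow> real ^ 'm \<Rightarrow> real ^ 'n) \<Rightarrow> (real ^ 'n \<Rightarrow> real ^ 'm \<Rightarrow> real ^ 'n) \<Rightarrow>
   (real ^ 'n \<Rightarrow> real) \<Rightarrow> real \<Rightarrow> real \<Rightarrow> bool" where
  "exp_ISS_Lyapunov f g V c d \<longleftrightarrow>
     smooth V \<and> (\<forall>x. 0 \<le> V x) \<and>
     (\<exists>\<psi>1 \<psi>2. class_K_inf \<psi>1 \<and> class_K_inf \<psi>2 \<and>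
        (\<forall>x. \<psi>1 (norm x) \<le> V x \<and> V x \<le> \<psi>2 (norm x))) \<and>
     (\<exists>\<rho>. class_K_inf \<rho> \<and>
        (\<forall>x u. V x \<ge> \<rho> (norm u) \<longrightarrow>
           gradient V x \<bullet> f x u \<le> - c * V x \<and> V (g x u) \<le> exp (- d) * V x))"

end

(* Along a solution, let s be the last time at which V <= rho(|u|_oo). After s both dissipation
   inequalities are in force, so V decays over (s, t] at least by the factor
   exp (- d N(t, s) - c (t - s)) <= h(t - s) <= l(t - s), irrespective of the signs of c and d.
   At s itself V is bounded by a K_oo function mu of |u|_oo, even if the trajectory leaves the
   sublevel set by a jump, because g is bounded on bounded sets and continuous at 0. Hence
   V(x(t)) <= l(0) mu(|u|_oo); if there is no such s, then V(x(t)) <= l(t - t0) psi2(|x0|). *)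

theory Submission
  imports Defs
begin

subsection \<open>Absolutely continuous functions\<close>

text \<open>Two obstacles shape the proof. A solution satisfies the differential equation only
  almost everywhere, so decay between impulses cannot be read off a pointwise mean value theorem; it
  rests on the fact that an absolutely continuous function whose derivative is nonpositive almost
  everywhere is nonincreasing, applied to \<open>V (x t) * exp (c * t)\<close>. Moreover the
  dissipation inequalities say nothing about \<open>V (g x u)\<close> where \<open>V x\<close> is
  below \<open>\<rho> (norm u)\<close>, and this sublevel set is not invariant in general, so a
  trajectory may enter and leave it many times. The supremum of \<open>V (g x u)\<close> over that
  set is merely monotone in the input bound; an averaging step turns it into a continuous majorant
  \<mu>. With \<alpha> the inverse of \<psi>1, the comparison functions are \<beta>(r, t) =
  \<alpha>(l(t) \<psi>2(r)) and \<gamma>(r) = \<alpha>(l(0) \<mu>(r)). Positivity of h makes l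
  positive, which gives strict monotonicity in r.\<close>

lemma abs_continuous_onE:
  assumes "abs_continuous_on S x" "\<epsilon> > 0"
  obtains \<delta> where "\<delta> > 0"
    "\<forall>D A. D division_of A \<longrightarrow> A \<subseteq> S \<longrightarrow> (\<Sum>K\<in>D. Sup K - Inf K) < \<delta> \<longrightarrow>
      (\<Sum>K\<in>D. norm (x (Sup K) - x (Inf K))) < \<epsilon>"
  using assms unfolding abs_continuous_on_def by meson

lemma abs_continuous_on_imp_continuous_on:
  fixes x :: "real \<Rightarrow> 'a::real_normed_vector"
  assumes "abs_continuous_on {a..b} x"
  shows "continuous_on {a..b} x"
  unfolding continuous_on_iff
proof (intro ballI allI impI)
  fix t and e :: real
  assume t: "t \<in> {a..b}" and e: "0 < e"
  obtain \<delta> where \<delta>: "\<delta> > 0" and ac\<delta>: "\<forall>D A. D division_of A \<longrightarrow> A \<subseteq> {a..b} \<longrightarrow>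
      (\<Sum>K\<in>D. Sup K - Inf K) < \<delta> \<longrightarrow> (\<Sum>K\<in>D. norm (x (Sup K) - x (Inf K))) < e"
    by (rule abs_continuous_onE[OF assms e])
  note * = ac\<delta>[rule_format]
  \<comment> \<open>A single interval is already a division, so absolute continuity contains uniform
    continuity.\<close>
  have close: "norm (x q - x p) < e" if "p \<in> {a..b}" "q \<in> {a..b}" "p \<le> q" "q - p < \<delta>" for p q
    using *[of "{{p..q}}" "{p..q}"] division_of_self[of p q] that by auto
  show "\<exists>d>0. \<forall>s\<in>{a..b}. dist s t < d \<longrightarrow> dist (x s) (x t) < e"
  proof (intro exI[of _ \<delta>] conjI ballI impI \<delta>)
    fix s assume "s \<in> {a..b}" "dist s t < \<delta>"
    then show "dist (x s) (x t) < e"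
      using close[of s t] close[of t s] t
      by (cases "s \<le> t") (auto simp: dist_norm dist_real_def norm_minus_commute)
  qed
qed

text \<open>The increment bound is summed over the cells of a division. The extra term
  \<open>q - p\<close> is there for functions that also depend explicitly on time, such as
  \<open>V (x t) * exp (c * t)\<close>; its sum is the total length, which is small as well.\<close>

lemma abs_continuous_on_lipschitz_image:
  fixes x :: "real \<Rightarrow> 'a::real_normed_vector" and z :: "real \<Rightarrow> 'b::real_normed_vector"
  assumes ac: "abs_continuous_on S x"
    and lip: "\<And>p q. p \<in> S \<Longrightarrow> q \<in> S \<Longrightarrow> p \<le> q \<Longrightarrow> norm (z q - z p) \<le> L * (norm (x q - x p) + (q - p))"
  shows "abs_continuous_on S z"
  unfolding abs_continuous_on_def
proof (intro allI impI)
  fix e :: real assume e: "0 < e"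
  \<comment> \<open>Enlarging \<open>L\<close> to at least 1 permits division by it; each of the two
    sums then receives the budget \<open>e / (2 * M)\<close>.\<close>
  define M where "M = max L 1"
  have M: "M \<ge> 1" "M \<ge> L" by (auto simp: M_def)
  have e2: "e / (2 * M) > 0" using e M by auto
  obtain \<delta> where \<delta>: "\<delta> > 0" and ac\<delta>: "\<forall>D A. D division_of A \<longrightarrow> A \<subseteq> S \<longrightarrow>
      (\<Sum>K\<in>D. Sup K - Inf K) < \<delta> \<longrightarrow> (\<Sum>K\<in>D. norm (x (Sup K) - x (Inf K))) < e / (2 * M)"
    by (rule abs_continuous_onE[OF ac e2])
  note * = ac\<delta>[rule_format]
  show "\<exists>\<delta>>0. \<forall>D A. D division_of A \<and> A \<subseteq> S \<and> (\<Sum>K\<in>D. Sup K - Inf K) < \<delta> \<longrightarrow>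
      (\<Sum>K\<in>D. norm (z (Sup K) - z (Inf K))) < e"
  proof (intro exI[of _ "min \<delta> (e / (2 * M))"] conjI allI impI)
    show "0 < min \<delta> (e / (2 * M))" using \<delta> e2 by simp
  next
    fix D A assume D: "D division_of A \<and> A \<subseteq> S \<and> (\<Sum>K\<in>D. Sup K - Inf K) < min \<delta> (e / (2 * M))"
    have "norm (z (Sup K) - z (Inf K)) \<le> M * (norm (x (Sup K) - x (Inf K)) + (Sup K - Inf K))"
      if "K \<in> D" for K
    proof -
      have "K \<subseteq> A" "K \<noteq> {}" and "\<exists>p q. K = cbox p q"
        using division_ofD(2-4)[OF conjunct1[OF D] that] by auto
      then obtain p q where K: "K = {p..q}" by auto
      have "p \<le> q" using \<open>K \<noteq> {}\<close> by (simp add: K)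
      have "{p..q} \<subseteq> S" using \<open>K \<subseteq> A\<close> D by (metis K order_trans)
      with \<open>p \<le> q\<close> have pq: "Sup K = q" "Inf K = p" "p \<in> S" "q \<in> S" "p \<le> q"
        by (auto simp: K)
      have "norm (z q - z p) \<le> L * (norm (x q - x p) + (q - p))" using lip pq by blast
      also have "\<dots> \<le> M * (norm (x q - x p) + (q - p))"
        using M pq by (intro mult_right_mono) auto
      finally show ?thesis using pq by simp
    qed
    then have "(\<Sum>K\<in>D. norm (z (Sup K) - z (Inf K))) \<le>
        (\<Sum>K\<in>D. M * (norm (x (Sup K) - x (Inf K)) + (Sup K - Inf K)))"
      by (rule sum_mono)
    also have "\<dots> = M * ((\<Sum>K\<in>D. norm (x (Sup K) - x (Inf K))) + (\<Sum>K\<in>D. Sup K - Inf K))"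
      by (subst sum.distrib[symmetric]) (rule sum_distrib_left[symmetric])
    also have "\<dots> < M * (e / (2 * M) + e / (2 * M))"
      using *[of D A] D M by (intro mult_strict_left_mono add_strict_mono) auto
    also have "\<dots> = e" using M by (simp add: field_simps)
    finally show "(\<Sum>K\<in>D. norm (z (Sup K) - z (Inf K))) < e" .
  qed
qed

text \<open>The points \<open>u\<close> and \<open>v\<close> lie on opposite sides of
  \<open>t\<close>, so the two linearization errors add up to at most \<eta> times (v - t) + (t - u)
  = v - u. For points on the same side the error would not be controlled by their distance.\<close>

lemma straddle_nonpos_derivative:
  fixes z :: "real \<Rightarrow> real"
  assumes "(z has_real_derivative D) (at t)" "D \<le> 0" "\<eta> > 0"
  shows "\<exists>r>0. \<forall>u v. u \<le> t \<and> t \<le> v \<and> u \<in> ball t r \<and> v \<in> ball t r \<longrightarrow> z v - z u \<le> \<eta> * (v - u)"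
proof -
  obtain r where r: "r > 0" "\<And>y. norm (y - t) < r \<Longrightarrow> norm (z y - z t - D * (y - t)) \<le> \<eta> * norm (y - t)"
    using assms(1,3) unfolding has_field_derivative_def has_derivative_at_alt by blast
  show ?thesis
  proof (intro exI[of _ r] conjI allI impI r)
    fix u v assume uv: "u \<le> t \<and> t \<le> v \<and> u \<in> ball t r \<and> v \<in> ball t r"
    have "D * (v - u) \<le> 0" using uv assms(2) by (intro mult_nonpos_nonneg) auto
    moreover have "z v - z t - D * (v - t) \<le> \<eta> * (v - t)"
      using r(2)[of v] uv by (auto simp: dist_real_def)
    moreover have "- (z u - z t - D * (u - t)) \<le> \<eta> * (t - u)"
      using r(2)[of u] uv by (auto simp: dist_real_def)
    ultimately show "z v - z u \<le> \<eta> * (v - u)" by (simp add: algebra_simps)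
  qed
qed

text \<open>Take a division fine for a gauge that makes \<open>z\<close> grow at rate at most \<open>\<epsilon>\<close> around tags where the
  derivative is nonpositive and confines the other cells to an open set of small measure, where
  absolute continuity applies.\<close>

lemma abs_continuous_on_nonpos_derivative:
  fixes z :: "real \<Rightarrow> real"
  assumes ac: "abs_continuous_on {a..b} z" and ab: "a \<le> b"
    and ae: "AE t in lebesgue. a < t \<and> t < b \<longrightarrow> (\<exists>D\<le>0. (z has_real_derivative D) (at t))"
  shows "z b \<le> z a"
proof -
  have "z b - z a \<le> \<epsilon> * (b - a) + \<epsilon>" if \<epsilon>: "\<epsilon> > 0" for \<epsilon>
  proof -
    obtain \<delta> where \<delta>: "\<delta> > 0" and ac\<delta>: "\<forall>D A. D division_of A \<longrightarrow> A \<subseteq> {a..b} \<longrightarrow>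
      (\<Sum>K\<in>D. Sup K - Inf K) < \<delta> \<longrightarrow> (\<Sum>K\<in>D. norm (z (Sup K) - z (Inf K))) < \<epsilon>"
      by (rule abs_continuous_onE[OF ac \<epsilon>])
    note * = ac\<delta>[rule_format]
    obtain N0 where N0: "\<And>t. a < t \<Longrightarrow> t < b \<Longrightarrow> t \<notin> N0 \<Longrightarrow> \<exists>D\<le>0. (z has_real_derivative D) (at t)"
        "N0 \<in> null_sets lebesgue"
    proof (rule AE_E3[OF ae])
      fix N assume "\<And>t. t \<in> space lebesgue - N \<Longrightarrow> a < t \<and> t < b \<longrightarrow> (\<exists>D\<le>0. (z has_real_derivative D) (at t))"
        "N \<in> null_sets lebesgue"
      then show thesis by (intro that[of N]) (simp_all add: space_completion)
    qed
    \<comment> \<open>The end points carry no derivative information, so they join the exceptional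
      set, which stays negligible.\<close>
    define N where "N = insert a (insert b N0)"
    have "negligible N0" using N0(2) negligible_iff_null_sets by blast
    then have negN: "negligible N"
      by (simp add: N_def)
    have "N \<in> sets lebesgue"
      using negN by (rule negligible_imp_sets)
    then obtain U where U: "open U" "N \<subseteq> U" "(U - N) \<in> lmeasurable" "emeasure lebesgue (U - N) < ennreal \<delta>"
      by (rule sets_lebesgue_outer_open[OF _ \<delta>])
    have Nm: "N \<in> lmeasurable" "measure lebesgue N = 0"
      using negligible_imp_measurable[OF negN] negligible_imp_measure0[OF negN] by auto
    have UN: "U = (U - N) \<union> N" using U(2) by blast
    have Um: "U \<in> lmeasurable"
      by (subst UN) (rule fmeasurable.Un[OF U(3) Nm(1)])
    have "measure lebesgue U \<le> measure lebesgue (U - N) + measure lebesgue N"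
      by (subst UN) (rule measure_Un_le[OF fmeasurableD[OF U(3)] fmeasurableD[OF Nm(1)]])
    moreover have "measure lebesgue (U - N) < \<delta>"
      using U(4) \<delta> unfolding emeasure_eq_measure2[OF U(3)] by (simp add: ennreal_less_iff)
    ultimately have U\<delta>: "measure lebesgue U < \<delta>" using Nm(2) by linarith
    define P where "P t r \<longleftrightarrow> 0 < r \<and> (t \<in> N \<longrightarrow> ball t r \<subseteq> U) \<and> (t \<notin> N \<longrightarrow> t \<in> {a..b} \<longrightarrow>
        (\<forall>u v. u \<le> t \<and> t \<le> v \<and> u \<in> ball t r \<and> v \<in> ball t r \<longrightarrow> z v - z u \<le> \<epsilon> * (v - u)))" for t r
    have "\<exists>r. P t r" for t
    proof (cases "t \<in> N")
      case True
      then obtain r where "r > 0" "ball t r \<subseteq> U"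
        using U(1,2) by (meson openE subsetD)
      then show ?thesis using True unfolding P_def by blast
    next
      case False
      show ?thesis
      proof (cases "t \<in> {a..b}")
        case True
        then have "a < t" "t < b" using False by (auto simp: N_def less_le)
        then obtain D where "D \<le> 0" "(z has_real_derivative D) (at t)"
          using False N0(1)[of t] by (auto simp: N_def)
        then show ?thesis
          using straddle_nonpos_derivative[of z D t \<epsilon>] \<epsilon> False unfolding P_def by meson
      next
        \<comment> \<open>The gauge must be positive on the whole line; outside the interval any
          radius serves, and 1 is the default.\<close>
        case out: False
        then have "P t 1" using False by (auto simp: P_def)
        then show ?thesis ..
      qed
    qed
    then obtain r where rP: "\<And>t. P t (r t)" by metis
    have r: "r t > 0" "t \<in> N \<Longrightarrow> ball t (r t) \<subseteq> U" for t
      using rP[of t] by (simp_all add: P_def)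
    have r3: "z v - z u \<le> \<epsilon> * (v - u)" if "t \<notin> N" "t \<in> {a..b}" "u \<le> t" "t \<le> v"
      "u \<in> ball t (r t)" "v \<in> ball t (r t)" for t u v
      using rP[of t] that unfolding P_def by blast
    have "gauge (\<lambda>t. ball t (r t))" using r(1) by (simp add: gauge_def)
    then obtain p where p: "p tagged_division_of {a..b}" "(\<lambda>t. ball t (r t)) fine p"
      by (rule fine_division_exists_real)
    note pD = tagged_division_ofD[OF p(1)]
    have pK: "Inf K \<le> t \<and> t \<le> Sup K \<and> Inf K \<in> K \<and> Sup K \<in> K \<and> K \<subseteq> ball t (r t) \<and> t \<in> {a..b}
        \<and> K = {Inf K..Sup K}"
      if tK: "(t, K) \<in> p" for t K
    proof -
      obtain u v where uv: "K = {u..v}" using pD(4)[OF tK] by auto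
      have "t \<in> K" using pD(2)[OF tK] .
      then have "u \<le> v" using uv by auto
      then have "Inf K = u" "Sup K = v" using uv by auto
      then show ?thesis using uv \<open>t \<in> K\<close> p(2) pD(3)[OF tK] tK \<open>u \<le> v\<close> by (auto simp: fine_def)
    qed
    define p1 where "p1 = {(t, K) \<in> p. t \<notin> N}"
    define p2 where "p2 = {(t, K) \<in> p. t \<in> N}"
    have p12: "p = p1 \<union> p2" "p1 \<inter> p2 = {}" "finite p1" "finite p2" "p1 \<subseteq> p" "p2 \<subseteq> p"
      using pD(1) by (auto simp: p1_def p2_def intro: rev_finite_subset)
    let ?z = "\<lambda>(t::real, K). z (Sup K) - z (Inf K)"
    have "sum ?z p1 \<le> (\<Sum>(t, K)\<in>p1. \<epsilon> * (Sup K - Inf K))"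
    proof (rule sum_mono, clarify)
      fix t K assume "(t, K) \<in> p1"
      then have "(t, K) \<in> p" "t \<notin> N" by (auto simp: p1_def)
      then show "z (Sup K) - z (Inf K) \<le> \<epsilon> * (Sup K - Inf K)"
        using pK[of t K] by (intro r3[of t]) auto
    qed
    also have "\<dots> \<le> (\<Sum>(t, K)\<in>p. \<epsilon> * (Sup K - Inf K))"
    proof (rule sum_mono2[OF pD(1) p12(5)], clarify)
      fix t K assume "(t, K) \<in> p"
      then show "0 \<le> \<epsilon> * (Sup K - Inf K)" using pK[of t K] \<epsilon> by simp
    qed
    also have "\<dots> = \<epsilon> * (\<Sum>(t, K)\<in>p. Sup K - Inf K)"
      by (simp add: sum_distrib_left split_def)
    also have "\<dots> = \<epsilon> * (b - a)"
      using additive_tagged_division_1[OF ab p(1), of "\<lambda>t. t"] by simp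
    finally have s1: "sum ?z p1 \<le> \<epsilon> * (b - a)" .
    have part: "p2 tagged_partial_division_of {a..b}"
      using p(1) p12 tagged_partial_division_subset unfolding tagged_division_of_def by blast
    define D where "D = snd ` p2"
    have div: "D division_of \<Union>D"
      unfolding D_def by (rule partial_division_of_tagged_division[OF part])
    \<comment> \<open>Different tags can share a cell only if its interior is empty. A sum over
      tagged pairs is therefore a sum over cells once the summand vanishes on such cells.\<close>
    have over: "(\<Sum>(t, K)\<in>p2. w K) = sum w D"
      if "\<And>u v. box u v = {} \<Longrightarrow> w (cbox u v) = 0" for w :: "real set \<Rightarrow> real"
      unfolding D_def
      by (rule sum.over_tagged_division_lemma[OF tagged_partial_division_of_Union_self[OF part]]) (rule that)
    have DK: "K \<noteq> {}" "K \<subseteq> U" "K \<subseteq> {a..b}" "K = {Inf K..Sup K}" "Inf K \<le> Sup K" if KD: "K \<in> D" for K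
    proof -
      obtain t where "(t, K) \<in> p" "t \<in> N" using KD by (auto simp: D_def p2_def)
      then show "K \<noteq> {}" "K \<subseteq> U" "K \<subseteq> {a..b}" "K = {Inf K..Sup K}" "Inf K \<le> Sup K"
        using pK[of t K] r(2)[of t] pD(3) by auto
    qed
    have len: "measure lebesgue {u..v} = v - u" if "u \<le> v" for u v :: real
      using that by (simp add: measure_completion)
    have "(\<Sum>K\<in>D. Sup K - Inf K) = sum (measure lebesgue) D"
    proof (rule sum.cong[OF refl])
      fix K assume "K \<in> D"
      then have "{Inf K..Sup K} = K" "Inf K \<le> Sup K" using DK(4,5)[of K] by blast+
      then show "Sup K - Inf K = measure lebesgue K"
        using len[of "Inf K" "Sup K"] by simp
    qed
    also have "\<dots> = measure lebesgue (\<Union>D)"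
      by (rule content_division[OF div])
    also have "\<dots> \<le> measure lebesgue U"
    proof (rule measure_mono_fmeasurable[OF _ _ Um])
      show "\<Union>D \<subseteq> U" using DK(2) by blast
      show "\<Union>D \<in> sets lebesgue"
        using div by (rule fmeasurableD[OF lmeasurable_division])
    qed
    also have "\<dots> < \<delta>" by (rule U\<delta>)
    finally have small: "(\<Sum>K\<in>D. norm (z (Sup K) - z (Inf K))) < \<epsilon>"
      using *[OF div] DK(3) by (simp add: Sup_le_iff)
    \<comment> \<open>The value 0 at the empty set meets the side condition of \<open>over\<close>,
      since \<open>Sup {}\<close> and \<open>Inf {}\<close> carry no information. One-point cells
      contribute 0 anyway.\<close>
    let ?w = "\<lambda>K. if K = {} then 0 else z (Sup K) - z (Inf K)"
    have ne: "K \<noteq> {}" if "(t, K) \<in> p2" for t K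
      using pK[of t K] p12(6) that by blast
    have "sum ?z p2 = (\<Sum>(t, K)\<in>p2. ?w K)"
      using ne by (intro sum.cong refl) auto
    also have "\<dots> = sum ?w D"
      by (rule over) (auto simp: box_real)
    also have "\<dots> \<le> (\<Sum>K\<in>D. norm (z (Sup K) - z (Inf K)))"
      by (intro sum_mono) auto
    finally have s2: "sum ?z p2 \<le> \<epsilon>" using small by simp
    have "z b - z a = sum ?z p"
      using additive_tagged_division_1[OF ab p(1), of z] by simp
    also have "\<dots> = sum ?z p1 + sum ?z p2"
      using p12 by (simp add: sum.union_disjoint)
    finally show ?thesis using s1 s2 by simp
  qed
  then have le: "z b - z a \<le> \<epsilon> * (b - a + 1)" if "\<epsilon> > 0" for \<epsilon>
    using that by (simp add: algebra_simps)
  show ?thesis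
  proof (rule ccontr)
    assume "\<not> z b \<le> z a"
    define k where "k = b - a + 1"
    have "k > 0" using ab by (simp add: k_def)
    \<comment> \<open>The choice of \<epsilon> as the gap divided by \<open>2 * k\<close> bounds the
      gap by half of itself.\<close>
    then have "z b - z a \<le> (z b - z a) / (2 * k) * k"
      using \<open>\<not> z b \<le> z a\<close> unfolding k_def by (intro le) simp
    also have "\<dots> = (z b - z a) / 2" using \<open>k > 0\<close> by simp
    finally show False using \<open>\<not> z b \<le> z a\<close> by simp
  qed
qed

subsection \<open>Comparison functions\<close>

lemma class_KD:
  assumes "class_K \<gamma>"
  shows "continuous_on {0..} \<gamma>" "\<gamma> 0 = 0" "\<And>r. 0 < r \<Longrightarrow> 0 < \<gamma> r" "\<And>r. 0 \<le> r \<Longrightarrow> 0 \<le> \<gamma> r"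
    "\<And>r s. 0 \<le> r \<Longrightarrow> r < s \<Longrightarrow> \<gamma> r < \<gamma> s" "\<And>r s. 0 \<le> r \<Longrightarrow> r \<le> s \<Longrightarrow> \<gamma> r \<le> \<gamma> s"
proof -
  have P: "class_P \<gamma>" and m: "strict_mono_on {0..} \<gamma>" using assms by (auto simp: class_K_def)
  then show 1: "continuous_on {0..} \<gamma>" "\<gamma> 0 = 0" "\<And>r. 0 < r \<Longrightarrow> 0 < \<gamma> r" by (auto simp: class_P_def)
  show "0 \<le> \<gamma> r" if "0 \<le> r" for r
    using 1(2) 1(3)[of r] that by (cases "r = 0") auto
  show 2: "\<gamma> r < \<gamma> s" if "0 \<le> r" "r < s" for r s
    using m that by (auto simp: strict_mono_on_def)
  show "\<gamma> r \<le> \<gamma> s" if "0 \<le> r" "r \<le> s" for r s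
    using 2[of r s] that by (cases "r = s") auto
qed

lemma class_KI:
  assumes "continuous_on {0..} \<gamma>" "\<gamma> 0 = 0" "\<And>r s. 0 \<le> r \<Longrightarrow> r < s \<Longrightarrow> \<gamma> r < \<gamma> s"
  shows "class_K \<gamma>"
  unfolding class_K_def class_P_def strict_mono_on_def
  using assms assms(3)[of 0] by auto

lemma class_K_infD:
  assumes "class_K_inf \<gamma>"
  shows "class_K \<gamma>" "\<exists>r\<ge>0. y \<le> \<gamma> r"
proof -
  show "class_K \<gamma>" using assms by (simp add: class_K_inf_def)
  have "\<not> bdd_above (\<gamma> ` {0..})" using assms by (simp add: class_K_inf_def)
  then show "\<exists>r\<ge>0. y \<le> \<gamma> r"
    by (metis atLeast_iff bdd_aboveI2 linear)
qed

lemma class_K_infI: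
  assumes "class_K \<gamma>" "\<And>y. \<exists>r\<ge>0. y \<le> \<gamma> r"
  shows "class_K_inf \<gamma>"
  unfolding class_K_inf_def
proof (intro conjI assms(1) notI)
  assume "bdd_above (\<gamma> ` {0..})"
  then obtain M where M: "\<And>r. 0 \<le> r \<Longrightarrow> \<gamma> r \<le> M" by (auto simp: bdd_above_def)
  show False using assms(2)[of "M + 1"] M by fastforce
qed

lemma class_K_inf_surj:
  assumes "class_K_inf \<gamma>" "0 \<le> y"
  shows "\<exists>r\<ge>0. \<gamma> r = y"
proof -
  note K = class_KD[OF class_K_infD(1)[OF assms(1)]]
  obtain r where r: "r \<ge> 0" "y \<le> \<gamma> r" using class_K_infD(2)[OF assms(1)] by blast
  have "continuous_on {0..r} \<gamma>" using K(1) by (rule continuous_on_subset) auto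
  then obtain s where "0 \<le> s" "s \<le> r" "\<gamma> s = y"
    using IVT'[of \<gamma> 0 y r] K(2) assms(2) r by auto
  then show ?thesis by blast
qed

text \<open>A continuous injection of a half-line is a homeomorphism onto its image, which supplies
  the continuity of the inverse. The one-sided cancellation in the conclusion is the form that later
  converts a bound on \<open>\<psi>1 (norm x)\<close> into one on \<open>norm x\<close>.\<close>

lemma class_K_inf_inverse:
  assumes "class_K_inf \<gamma>"
  obtains \<gamma>' where "class_K_inf \<gamma>'" "\<And>r y. 0 \<le> r \<Longrightarrow> \<gamma> r \<le> y \<Longrightarrow> r \<le> \<gamma>' y"
proof -
  note K = class_KD[OF class_K_infD(1)[OF assms]]
  have "\<gamma> ` {0..} = {0..}"
    using class_K_inf_surj[OF assms] K(4) by (fastforce simp: image_iff)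
  moreover have "inj_on \<gamma> {0..}"
    using K(5) by (metis atLeast_iff inj_onI less_irrefl linorder_neqE_linordered_idom)
  moreover have "path_connected {0::real..}" by (intro convex_imp_path_connected convex_real_interval)
  ultimately obtain \<gamma>' where h: "homeomorphism {0..} {0..} \<gamma> \<gamma>'"
    using homeomorphism_into_1d K(1) by blast
  have left: "\<gamma>' (\<gamma> r) = r" if "0 \<le> r" for r
    using homeomorphism_apply1[OF h] that by simp
  have right: "\<gamma> (\<gamma>' y) = y" "0 \<le> \<gamma>' y" if "0 \<le> y" for y
    using homeomorphism_apply2[OF h, of y] homeomorphism_image2[OF h] that by auto
  have cont: "continuous_on {0..} \<gamma>'"
    using homeomorphism_cont2[OF h] .
  have strict: "\<gamma>' y < \<gamma>' y'" if "0 \<le> y" "y < y'" for y y'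
    using K(6)[of "\<gamma>' y'" "\<gamma>' y"] right[of y] right[of y'] that by force
  have "class_K \<gamma>'"
    using cont left[of 0] K(2) strict by (intro class_KI) auto
  \<comment> \<open>Here \<open>r\<close> may be negative, hence the truncation
    \<open>max 0 r\<close> in the witness.\<close>
  moreover have "\<exists>y\<ge>0. r \<le> \<gamma>' y" for r
    using left[of "max 0 r"] K(4)[of "max 0 r"] by (intro exI[of _ "\<gamma> (max 0 r)"]) auto
  ultimately have "class_K_inf \<gamma>'" by (rule class_K_infI)
  moreover have "r \<le> \<gamma>' y" if "0 \<le> r" "\<gamma> r \<le> y" for r y
    using strict[of "\<gamma> r" y] left[of r] K(4)[of r] that by (cases "\<gamma> r = y") auto
  ultimately show thesis by (rule that)
qed

lemma class_K_compose:
  assumes \<alpha>: "class_K \<alpha>" and \<psi>: "class_K \<psi>" and k: "0 < (k::real)"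
  shows "class_K (\<lambda>r. \<alpha> (k * \<psi> r))"
proof (rule class_KI)
  have "continuous_on {0..} (\<lambda>r. k * \<psi> r)"
    by (rule continuous_on_mult[OF continuous_on_const class_KD(1)[OF \<psi>]])
  moreover have "(\<lambda>r. k * \<psi> r) ` {0..} \<subseteq> {0..}"
    using k class_KD(4)[OF \<psi>] by (simp add: image_subset_iff)
  ultimately show "continuous_on {0..} (\<lambda>r. \<alpha> (k * \<psi> r))"
    by (rule continuous_on_compose2[OF class_KD(1)[OF \<alpha>]])
  show "\<alpha> (k * \<psi> 0) = 0" using class_KD(2)[OF \<alpha>] class_KD(2)[OF \<psi>] by simp
  show "\<alpha> (k * \<psi> r) < \<alpha> (k * \<psi> s)" if "0 \<le> r" "r < s" for r s
  proof (rule class_KD(5)[OF \<alpha>])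
    show "0 \<le> k * \<psi> r" using k class_KD(4)[OF \<psi> that(1)] by simp
    show "k * \<psi> r < k * \<psi> s" using k class_KD(5)[OF \<psi> that] by simp
  qed
qed

text \<open>This is the shape of the decay term: \<alpha> undoes the lower bound on V, \<psi> is the
  upper bound, and \<open>l\<close> carries the time decay. Positivity of \<open>l\<close> keeps
  each section in \<open>r\<close> strictly increasing.\<close>

lemma class_KL_compose:
  assumes "class_K_inf \<alpha>" "class_K \<psi>" "class_L l" "\<And>t. 0 \<le> t \<Longrightarrow> 0 < l t"
  shows "class_KL (\<lambda>r t. \<alpha> (l t * \<psi> r))"
proof -
  note A = class_KD[OF class_K_infD(1)[OF assms(1)]]
  note P = class_KD[OF assms(2)]
  have L: "continuous_on {0..} l" "(l \<longlongrightarrow> 0) at_top" "strict_antimono_on {0..} l"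
    using assms(3) by (auto simp: class_L_def)
  have K: "class_K (\<lambda>r. \<alpha> (l t * \<psi> r))" if "0 \<le> t" for t
    by (rule class_K_compose[OF class_K_infD(1)[OF assms(1)] assms(2) assms(4)[OF that]])
  have "class_L (\<lambda>t. \<alpha> (l t * \<psi> r))" if r: "0 < r" for r
    unfolding class_L_def
  proof (intro conjI allI impI)
    have pos: "0 \<le> l t * \<psi> r" if "0 \<le> t" for t
      using assms(4)[OF that] P(3)[OF r] by simp
    have "continuous_on {0..} (\<lambda>t. l t * \<psi> r)" by (intro continuous_intros L(1))
    moreover have "(\<lambda>t. l t * \<psi> r) ` {0..} \<subseteq> {0..}" using pos by auto
    ultimately show "continuous_on {0..} (\<lambda>t. \<alpha> (l t * \<psi> r))"
      by (rule continuous_on_compose2[OF A(1)])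
    show "0 \<le> \<alpha> (l t * \<psi> r)" if "0 \<le> t" for t using pos[OF that] by (rule A(4))
    show "strict_antimono_on {0..} (\<lambda>t. \<alpha> (l t * \<psi> r))"
    proof (rule monotone_onI)
      fix s t :: real assume "s \<in> {0..}" "t \<in> {0..}" "s < t"
      moreover from this have "l t < l s" using monotone_onD[OF L(3), of s t] by simp
      ultimately show "\<alpha> (l s * \<psi> r) > \<alpha> (l t * \<psi> r)"
        using pos[of t] P(3)[OF r] \<open>t \<in> {0..}\<close> by (intro A(5)) simp_all
    qed
    have "((\<lambda>t. l t * \<psi> r) \<longlongrightarrow> 0) at_top"
      using tendsto_mult_left_zero[OF L(2)] by simp
    moreover have "eventually (\<lambda>t. l t * \<psi> r \<in> {0..}) at_top"
      using eventually_ge_at_top[of 0] by eventually_elim (use pos in auto)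
    ultimately have "((\<lambda>t. \<alpha> (l t * \<psi> r)) \<longlongrightarrow> \<alpha> 0) at_top"
      using continuous_on_tendsto_compose[OF A(1), of "\<lambda>t. l t * \<psi> r" 0 at_top] by simp
    then show "((\<lambda>t. \<alpha> (l t * \<psi> r)) \<longlongrightarrow> 0) at_top" by (simp add: A(2))
  qed
  then show ?thesis using K unfolding class_KL_def by blast
qed

lemma class_K_inf_compose:
  assumes "class_K_inf \<alpha>" "class_K_inf \<psi>" "0 < (k::real)"
  shows "class_K_inf (\<lambda>r. \<alpha> (k * \<psi> r))"
proof (rule class_K_infI)
  note A = class_KD[OF class_K_infD(1)[OF assms(1)]]
  show "class_K (\<lambda>r. \<alpha> (k * \<psi> r))"
    by (rule class_K_compose[OF class_K_infD(1)[OF assms(1)] class_K_infD(1)[OF assms(2)] assms(3)])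
  fix y
  obtain s where s: "s \<ge> 0" "y \<le> \<alpha> s" using class_K_infD(2)[OF assms(1)] by blast
  obtain r where r: "r \<ge> 0" "s / k \<le> \<psi> r" using class_K_infD(2)[OF assms(2)] by blast
  have "s \<le> k * \<psi> r" using r(2) assms(3) by (simp add: field_simps)
  then show "\<exists>r\<ge>0. y \<le> \<alpha> (k * \<psi> r)"
    using s r A(6)[of s "k * \<psi> r"] by (intro exI[of _ r]) auto
qed

text \<open>The majorant is the average of \<open>\<omega>\<close> over \<open>[r, 2 r]\<close>, plus \<open>r\<close>. Written as
  the average of \<open>\<omega> (r s)\<close> over \<open>s\<close> it is visibly monotone, written as a difference of
  indefinite integrals it is visibly continuous for \<open>r > 0\<close>.\<close>

lemma mono_class_K_inf_majorant:
  fixes \<omega> :: "real \<Rightarrow> real"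
  assumes mono: "mono_on {0..} \<omega>" and zero: "\<omega> 0 = 0" and lim: "(\<omega> \<longlongrightarrow> 0) (at_right 0)"
  obtains \<gamma> where "class_K_inf \<gamma>" "\<And>r. 0 \<le> r \<Longrightarrow> \<omega> r \<le> \<gamma> r"
proof -
  define \<phi> where "\<phi> r = integral {1..2} (\<lambda>s. \<omega> (r * s))" for r
  define F where "F r = integral {0..r} \<omega>" for r
  have le: "\<omega> r \<le> \<omega> s" if "0 \<le> r" "r \<le> s" for r s
    using mono that by (auto simp: mono_on_def)
  have int: "\<omega> integrable_on {a..b}" if "0 \<le> a" for a b
    using le that by (intro integrable_on_mono_on mono_onI) auto
  have intm: "(\<lambda>s. \<omega> (r * s)) integrable_on {1..2}" if "0 \<le> r" for r
    using le that by (intro integrable_on_mono_on mono_onI) (auto intro!: le mult_left_mono)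
  have lower: "\<omega> r \<le> \<phi> r" and upper: "\<phi> r \<le> \<omega> (2 * r)" if r: "0 \<le> r" for r
  proof -
    have "integral {1..2} (\<lambda>s::real. \<omega> r) \<le> \<phi> r"
      unfolding \<phi>_def using r
      by (intro integral_le intm integrable_const_ivl le) (auto simp: mult_le_cancel_left1)
    then show "\<omega> r \<le> \<phi> r" by simp
    have "\<phi> r \<le> integral {1..2} (\<lambda>s::real. \<omega> (2 * r))"
      unfolding \<phi>_def using r
      by (intro integral_le intm integrable_const_ivl le) (auto simp: mult.commute[of r] mult_right_mono)
    then show "\<phi> r \<le> \<omega> (2 * r)" by simp
  qed
  have \<phi>_nonneg: "0 \<le> \<phi> r" if "0 \<le> r" for r
    using le[OF order_refl that] zero lower[OF that] by linarith
  have \<phi>_mono: "\<phi> r \<le> \<phi> s" if "0 \<le> r" "r \<le> s" for r s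
    unfolding \<phi>_def using that by (intro integral_le intm le) (auto intro!: mult_right_mono)
  have \<phi>_F: "\<phi> r = (F (2 * r) - F r) / r" if r: "0 < r" for r
  proof -
    have "(\<lambda>x. x / r) ` {r..2 * r} = {1..2}"
      using r by (simp add: image_divide_atLeastAtMost)
    then have "\<phi> r = (1 / r) * integral {r..2 * r} \<omega>"
      using integral_stretch_real[of r r "2 * r" \<omega>] r by (simp add: \<phi>_def)
    moreover have "F r + integral {r..2 * r} \<omega> = F (2 * r)"
      unfolding F_def using r int by (intro Henstock_Kurzweil_Integration.integral_combine) auto
    ultimately show ?thesis by (simp add: field_simps)
  qed
  have F_cont: "continuous (at r) F" if r: "0 < r" for r
  proof -
    have "continuous_on {0..r + 1} F"
      unfolding F_def by (rule indefinite_integral_continuous_1[OF int]) simp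
    then show ?thesis
      using r by (intro continuous_on_interior[of "{0..r + 1}"]) auto
  qed
  have \<phi>_cont: "continuous (at r within {0..}) \<phi>" if "0 \<le> r" for r
  \<comment> \<open>The difference quotient of \<open>F\<close> makes no sense at 0. There \<phi> is
    squeezed between 0 and \<open>\<omega> (2 * r)\<close>, whose limit is 0.\<close>
  proof (cases "r = 0")
    case True
    have "((\<lambda>r. \<omega> (2 * r)) \<longlongrightarrow> 0) (at_right 0)"
    proof (rule filterlim_compose[OF lim])
      show "filterlim (\<lambda>r. 2 * r :: real) (at_right 0) (at_right 0)"
        unfolding filterlim_at using eventually_at_right_less[of "0::real"]
        by (auto intro!: tendsto_eq_intros elim: eventually_mono)
    qed
    moreover have "eventually (\<lambda>r. 0 \<le> \<phi> r) (at_right 0)" "eventually (\<lambda>r. \<phi> r \<le> \<omega> (2 * r)) (at_right 0)"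
      using eventually_at_right_less[of "0::real"] \<phi>_nonneg upper
      by (auto elim: eventually_mono)
    ultimately have "(\<phi> \<longlongrightarrow> 0) (at_right 0)"
      by (intro tendsto_sandwich[of "\<lambda>_. 0" \<phi> "at_right 0" "\<lambda>r. \<omega> (2 * r)" 0]) auto
    moreover have "\<phi> 0 = 0" by (simp add: \<phi>_def zero)
    ultimately show ?thesis
      by (simp add: True continuous_within at_within_Ici_at_right)
  next
    case False
    then have r: "0 < r" using that by simp
    have "continuous (at r) (\<lambda>r. (F (2 * r) - F r) / r)"
      using r F_cont[of "2 * r"] F_cont[of r]
      by (intro continuous_intros continuous_at_compose[of r "\<lambda>r. 2 * r" F, unfolded o_def]) auto
    moreover have "eventually (\<lambda>r. (F (2 * r) - F r) / r = \<phi> r) (nhds r)"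
      using eventually_nhds_in_open[of "{0<..}" r] r by (auto elim!: eventually_mono simp: \<phi>_F)
    ultimately have "continuous (at r) \<phi>"
      by (rule isCont_cong[THEN iffD1, rotated])
    then show ?thesis by (rule continuous_at_imp_continuous_at_within)
  qed
  \<comment> \<open>The average need be neither strictly increasing nor unbounded; the added
    \<open>r\<close> provides both.\<close>
  have "class_K (\<lambda>r. \<phi> r + r)"
  proof (rule class_KI)
    show "continuous_on {0..} (\<lambda>r. \<phi> r + r)"
      using \<phi>_cont by (intro continuous_intros) (auto simp: continuous_on_eq_continuous_within)
    show "\<phi> 0 + 0 = 0" by (simp add: \<phi>_def zero)
    show "\<phi> r + r < \<phi> s + s" if "0 \<le> r" "r < s" for r s
      using \<phi>_mono[of r s] that by simp
  qed
  moreover have "\<exists>r\<ge>0. y \<le> \<phi> r + r" for y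
    using lower[of "max 0 y"] le[of 0 "max 0 y"] zero by (intro exI[of _ "max 0 y"]) auto
  ultimately have "class_K_inf (\<lambda>r. \<phi> r + r)" by (rule class_K_infI)
  moreover have "\<omega> r \<le> \<phi> r + r" if "0 \<le> r" for r
    using lower[OF that] that by linarith
  ultimately show thesis by (rule that)
qed

subsection \<open>Lyapunov functions along solutions\<close>

text \<open>\<open>gradient\<close> is a definite description, so uniqueness must be settled before
  anything can be said about it; \<open>C_k\<close> yields continuity coordinate by
  coordinate.\<close>

lemma smooth_gradient:
  fixes V :: "real ^ 'n \<Rightarrow> real"
  assumes "smooth V"
  shows "GDERIV V x :> gradient V x" "continuous_on UNIV (gradient V)"
proof -
  have "C_k (Suc 0) V" using assms unfolding smooth_def by blast
  then obtain G where G: "\<And>x. GDERIV V x :> G x" "\<And>i. continuous_on UNIV (\<lambda>x. G x $ i)"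
    by auto
  have "gradient V x = G x" for x
    unfolding gradient_def
  proof (rule the_equality)
    show "GDERIV V x :> G x" by (rule G(1))
    fix D assume "GDERIV V x :> D"
    then have "(\<lambda>h. h \<bullet> D) = (\<lambda>h. h \<bullet> G x)"
      using G(1)[of x] has_derivative_unique unfolding gderiv_def by blast
    \<comment> \<open>The two derivative functionals are compared at the vector
      \<open>D - G x\<close> itself.\<close>
    then have "(D - G x) \<bullet> D = (D - G x) \<bullet> G x" by meson
    then have "(D - G x) \<bullet> (D - G x) = 0" by (simp add: inner_diff_right)
    then show "D = G x" by simp
  qed
  then have *: "gradient V = G" by auto
  then show "GDERIV V x :> gradient V x" using G by simp
  have "continuous_on UNIV (\<lambda>x. \<chi> i. G x $ i)"
    using G(2) by (intro continuous_on_vec_lambda)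
  then show "continuous_on UNIV (gradient V)" by (simp add: *)
qed

text \<open>The gradient is bounded on a closed ball by compactness, and convexity of the ball
  admits the mean value inequality. The resulting constant transfers absolute continuity from a
  bounded curve to V along it.\<close>

lemma gderiv_lipschitz_cball:
  fixes V :: "'a::euclidean_space \<Rightarrow> real"
  assumes G: "\<And>x. GDERIV V x :> G x" and cont: "continuous_on UNIV G"
  obtains B where "B \<ge> 0" "\<And>p q. norm p \<le> R \<Longrightarrow> norm q \<le> R \<Longrightarrow> \<bar>V p - V q\<bar> \<le> B * norm (p - q)"
proof -
  have "compact (G ` cball 0 R)"
    using cont by (intro compact_continuous_image) (auto intro: continuous_on_subset)
  then obtain B where B: "B > 0" "\<And>p. norm p \<le> R \<Longrightarrow> norm (G p) \<le> B"
    using compact_imp_bounded by (force simp: bounded_pos)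
  have "\<bar>V p - V q\<bar> \<le> B * norm (p - q)" if pq: "norm p \<le> R" "norm q \<le> R" for p q
  proof -
    have "norm (V p - V q) \<le> B * norm (p - q)"
    proof (rule differentiable_bound[of "cball 0 R" V "\<lambda>x h. h \<bullet> G x"])
      fix x :: 'a assume x: "x \<in> cball 0 R"
      show "(V has_derivative (\<lambda>h. h \<bullet> G x)) (at x within cball 0 R)"
        using G[of x] unfolding gderiv_def by (rule has_derivative_at_withinI)
      show "onorm (\<lambda>h. h \<bullet> G x) \<le> B"
      proof (rule onorm_le)
        fix h
        have "norm (h \<bullet> G x) \<le> norm h * norm (G x)" using Cauchy_Schwarz_ineq2 by simp
        also have "\<dots> \<le> norm h * B" using B(2)[of x] x by (intro mult_left_mono) auto
        finally show "norm (h \<bullet> G x) \<le> B * norm h" by (simp add: mult.commute)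
      qed
    qed (use pq in auto)
    then show ?thesis by simp
  qed
  then show thesis using that[of B] B(1) by simp
qed

lemma abs_diff_exp_le:
  fixes p q c :: real
  assumes "p \<in> {a..b}" "q \<in> {a..b}"
  shows "\<bar>exp (c * q) - exp (c * p)\<bar> \<le> \<bar>c\<bar> * exp (\<bar>c\<bar> * max \<bar>a\<bar> \<bar>b\<bar>) * \<bar>q - p\<bar>"
proof -
  have "norm (exp (c * q) - exp (c * p)) \<le> (\<bar>c\<bar> * exp (\<bar>c\<bar> * max \<bar>a\<bar> \<bar>b\<bar>)) * norm (q - p)"
  proof (rule field_differentiable_bound[of "{a..b}" _ "\<lambda>t. c * exp (c * t)"])
    fix t assume t: "t \<in> {a..b}"
    show "((\<lambda>t. exp (c * t)) has_field_derivative c * exp (c * t)) (at t within {a..b})"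
      by (auto intro!: derivative_eq_intros)
    have "c * t \<le> \<bar>c\<bar> * \<bar>t\<bar>" by (metis abs_ge_self abs_mult)
    also have "\<dots> \<le> \<bar>c\<bar> * max \<bar>a\<bar> \<bar>b\<bar>" using t by (intro mult_left_mono) auto
    finally show "norm (c * exp (c * t)) \<le> \<bar>c\<bar> * exp (\<bar>c\<bar> * max \<bar>a\<bar> \<bar>b\<bar>)"
      by (simp add: abs_mult mult_left_mono)
  qed (use assms in auto)
  then show ?thesis by simp
qed

text \<open>With the integrating factor \<open>exp (c * t)\<close> the derivative of
  \<open>z\<close> is \<open>(G (x t) \<bullet> v + c * V (x t)) * exp (c * t)\<close>, which is
  nonpositive almost everywhere whatever the sign of \<open>c\<close>.\<close>

lemma lyapunov_flow_decay:
  fixes V :: "'a::euclidean_space \<Rightarrow> real" and x :: "real \<Rightarrow> 'a"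
  assumes G: "\<And>p. GDERIV V p :> G p" and cont: "continuous_on UNIV G"
    and ac: "abs_continuous_on {a..b} x" and ab: "a \<le> b"
    and ae: "AE t in lebesgue. a < t \<and> t < b \<longrightarrow>
      (\<exists>v. (x has_vector_derivative v) (at t) \<and> G (x t) \<bullet> v \<le> - c * V (x t))"
  shows "V (x b) \<le> exp (- c * (b - a)) * V (x a)"
proof -
  define z where "z t = V (x t) * exp (c * t)" for t
  have "compact (x ` {a..b})"
    by (intro compact_continuous_image abs_continuous_on_imp_continuous_on[OF ac]) simp
  then obtain R where R: "\<And>t. t \<in> {a..b} \<Longrightarrow> norm (x t) \<le> R"
    using compact_imp_bounded by (force simp: bounded_iff)
  obtain B where B: "B \<ge> 0" "\<And>p q. norm p \<le> R \<Longrightarrow> norm q \<le> R \<Longrightarrow> \<bar>V p - V q\<bar> \<le> B * norm (p - q)"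
    using gderiv_lipschitz_cball[OF G cont] by blast
  define E where "E = exp (\<bar>c\<bar> * max \<bar>a\<bar> \<bar>b\<bar>)"
  have E: "exp (c * t) \<le> E" if "t \<in> {a..b}" for t
  proof -
    have "c * t \<le> \<bar>c\<bar> * \<bar>t\<bar>" by (metis abs_ge_self abs_mult)
    also have "\<dots> \<le> \<bar>c\<bar> * max \<bar>a\<bar> \<bar>b\<bar>" using that by (intro mult_left_mono) auto
    finally show ?thesis by (simp add: E_def)
  qed
  have "E > 0" by (simp add: E_def)
  define W where "W = \<bar>V (x a)\<bar> + B * (R + R)"
  have W: "\<bar>V (x t)\<bar> \<le> W" if "t \<in> {a..b}" for t
  proof -
    have "\<bar>V (x t) - V (x a)\<bar> \<le> B * norm (x t - x a)" using B(2) R ab that by simp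
    also have "\<dots> \<le> B * (R + R)"
      using R[OF that] R[of a] ab B(1) norm_triangle_ineq4[of "x t" "x a"]
      by (intro mult_left_mono) auto
    finally show ?thesis by (simp add: W_def)
  qed
  have W0: "0 \<le> W" using W[of a] ab by simp
  have "abs_continuous_on {a..b} z"
  proof (rule abs_continuous_on_lipschitz_image[OF ac])
    fix p q assume pq: "p \<in> {a..b}" "q \<in> {a..b}" "p \<le> q"
    \<comment> \<open>A product rule for increments: one factor varies at a time, and each variation
      is bounded by the increment of \<open>x\<close> or by the elapsed time.\<close>
    have "z q - z p = (V (x q) - V (x p)) * exp (c * q) + V (x p) * (exp (c * q) - exp (c * p))"
      by (simp add: z_def algebra_simps)
    then have "\<bar>z q - z p\<bar> \<le> \<bar>V (x q) - V (x p)\<bar> * exp (c * q) + \<bar>V (x p)\<bar> * \<bar>exp (c * q) - exp (c * p)\<bar>"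
      by (metis abs_exp_cancel abs_mult abs_triangle_ineq)
    also have "\<dots> \<le> (B * norm (x q - x p)) * E + W * (\<bar>c\<bar> * E * (q - p))"
    proof (intro add_mono mult_mono)
      show "\<bar>V (x q) - V (x p)\<bar> \<le> B * norm (x q - x p)" using B(2) R pq by simp
      show "exp (c * q) \<le> E" using E pq by simp
      show "\<bar>V (x p)\<bar> \<le> W" using W pq by simp
      show "\<bar>exp (c * q) - exp (c * p)\<bar> \<le> \<bar>c\<bar> * E * (q - p)"
        using abs_diff_exp_le[OF pq(1,2), of c] pq(3) by (simp add: E_def)
    qed (use B W0 in auto)
    also have "\<dots> \<le> (B * E + W * \<bar>c\<bar> * E) * (norm (x q - x p) + (q - p))"
    proof -
      have "0 \<le> B * E * (q - p)" "0 \<le> W * \<bar>c\<bar> * E * norm (x q - x p)"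
        using B(1) W0 \<open>E > 0\<close> pq(3) by simp_all
      then show ?thesis by (simp add: algebra_simps)
    qed
    finally show "norm (z q - z p) \<le> (B * E + W * \<bar>c\<bar> * E) * (norm (x q - x p) + (q - p))" by simp
  qed
  moreover have "AE t in lebesgue. a < t \<and> t < b \<longrightarrow> (\<exists>D\<le>0. (z has_real_derivative D) (at t))"
    using ae
  proof (rule AE_mp, intro AE_I2 impI)
    fix t assume "a < t \<and> t < b \<longrightarrow> (\<exists>v. (x has_vector_derivative v) (at t) \<and> G (x t) \<bullet> v \<le> - c * V (x t))"
      and "a < t \<and> t < b"
    then obtain v where v: "(x has_vector_derivative v) (at t)" "G (x t) \<bullet> v \<le> - c * V (x t)" by blast
    have "((V \<circ> x) has_derivative (\<lambda>h. h \<bullet> G (x t)) \<circ> (\<lambda>h. h *\<^sub>R v)) (at t)"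
      using v(1) G[of "x t"] unfolding has_vector_derivative_def gderiv_def by (rule diff_chain_at)
    then have "((\<lambda>t. V (x t)) has_real_derivative G (x t) \<bullet> v) (at t)"
      unfolding has_field_derivative_def o_def inner_scaleR_left inner_commute[of v]
      by (simp add: mult_commute_abs)
    then have "(z has_real_derivative (G (x t) \<bullet> v) * exp (c * t) + V (x t) * (c * exp (c * t))) (at t)"
      unfolding z_def by (auto intro!: derivative_eq_intros)
    moreover have "(G (x t) \<bullet> v) * exp (c * t) + V (x t) * (c * exp (c * t)) =
        (G (x t) \<bullet> v + c * V (x t)) * exp (c * t)"
      by (simp add: algebra_simps)
    moreover have "\<dots> \<le> 0" using v(2) by (intro mult_nonpos_nonneg) auto
    ultimately show "\<exists>D\<le>0. (z has_real_derivative D) (at t)" by (intro exI conjI) simp_all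
  qed
  ultimately have "V (x b) * exp (c * b) \<le> V (x a) * exp (c * a)"
    using abs_continuous_on_nonpos_derivative[OF _ ab, of z] by (simp only: z_def)
  then have "V (x b) \<le> V (x a) * exp (c * a) / exp (c * b)"
    by (simp add: pos_le_divide_eq)
  also have "\<dots> = exp (- c * (b - a)) * V (x a)"
    by (simp add: exp_diff[symmetric] algebra_simps flip: times_divide_eq_right)
  finally show ?thesis .
qed

section \<open>Decay across impulses and the last entry into a sublevel set\<close>

lemma impulse_times_finite:
  assumes "impulse_times t0 T"
  shows "finite (range T \<inter> {s<..t})"
proof -
  have "finite ({s..t} \<inter> range T)"
    using assms by (intro finite_not_islimpt_in_compact) (auto simp: impulse_times_def)
  then show ?thesis by (rule rev_finite_subset) auto
qed

text \<open>Induction on the number of jumps, peeling off the last one at \<tau>. The interval (s,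
  \<tau>] already counts that jump, so the induction hypothesis is applied at times \<sigma> <
  \<tau> and passed to the left limit; the jump and a final stretch of flow supply the remaining
  factors.\<close>

lemma impulsive_decay:
  fixes y :: "real \<Rightarrow> real"
  assumes imp: "impulse_times t0 T"
    and flow: "\<And>p q. s \<le> p \<Longrightarrow> p \<le> q \<Longrightarrow> q \<le> t \<Longrightarrow> range T \<inter> {p<..q} = {} \<Longrightarrow>
        y q \<le> exp (- c * (q - p)) * y p"
    and left: "\<And>\<tau>. \<tau> \<in> range T \<Longrightarrow> s < \<tau> \<Longrightarrow> \<tau> \<le> t \<Longrightarrow> (y \<longlongrightarrow> l \<tau>) (at_left \<tau>)"
    and jump: "\<And>\<tau>. \<tau> \<in> range T \<Longrightarrow> s < \<tau> \<Longrightarrow> \<tau> \<le> t \<Longrightarrow> y \<tau> \<le> exp (- d) * l \<tau>"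
    and st: "s \<le> t"
  shows "y t \<le> exp (- d * num_jumps T t s - c * (t - s)) * y s"
  using st flow left jump
proof (induction "num_jumps T t s" arbitrary: t)
  case 0
  \<comment> \<open>Finiteness is essential here, since \<open>card\<close> is also 0 on infinite
    sets.\<close>
  then have "range T \<inter> {s<..t} = {}"
    using impulse_times_finite[OF imp, of s t] by (simp add: num_jumps_def)
  then have "y t \<le> exp (- c * (t - s)) * y s" using "0.prems"(1,2) by blast
  then show ?case using "0.hyps" by simp
next
  case (Suc n)
  define S where "S = range T \<inter> {s<..t}"
  have fin: "finite S" unfolding S_def by (rule impulse_times_finite[OF imp])
  have card: "card S = Suc n" using Suc.hyps(2) by (simp add: num_jumps_def S_def)
  define \<tau> where "\<tau> = Max S"
  have "S \<noteq> {}" using card by auto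
  then have "\<tau> \<in> S" using fin by (simp add: \<tau>_def)
  then have \<tau>: "\<tau> \<in> range T" "s < \<tau>" "\<tau> \<le> t" by (auto simp: S_def)
  have max: "\<sigma> \<le> \<tau>" if "\<sigma> \<in> S" for \<sigma> using fin that by (simp add: \<tau>_def)
  have "eventually (\<lambda>\<sigma>. \<forall>\<rho>\<in>S - {\<tau>}. \<rho> < \<sigma>) (at_left \<tau>)"
  proof (rule eventually_ball_finite)
    show "\<forall>\<rho>\<in>S - {\<tau>}. eventually (\<lambda>\<sigma>. \<rho> < \<sigma>) (at_left \<tau>)"
    proof
      fix \<rho> assume "\<rho> \<in> S - {\<tau>}"
      then have "\<rho> < \<tau>" using max by (auto simp: less_le)
      then show "eventually (\<lambda>\<sigma>. \<rho> < \<sigma>) (at_left \<tau>)"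
        by (rule order_tendstoD(1)[OF tendsto_ident_at])
    qed
  qed (use fin in simp)
  moreover have "eventually (\<lambda>\<sigma>. s < \<sigma> \<and> \<sigma> < \<tau>) (at_left \<tau>)"
    using eventually_at_left_real[OF \<tau>(2)] by simp
  ultimately have "eventually (\<lambda>\<sigma>. y \<sigma> \<le> exp (- d * n - c * (\<sigma> - s)) * y s) (at_left \<tau>)"
  proof eventually_elim
    case (elim \<sigma>)
    \<comment> \<open>Close to \<tau> on its left, \<sigma> lies beyond all other impulses of
      \<open>S\<close>, so shortening the interval to \<sigma> removes exactly \<tau>.\<close>
    have "range T \<inter> {s<..\<sigma>} = S - {\<tau>}"
    proof (intro set_eqI iffI)
      fix \<rho> assume "\<rho> \<in> range T \<inter> {s<..\<sigma>}"
      then show "\<rho> \<in> S - {\<tau>}" using elim(2) \<tau>(3) by (simp add: S_def)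
    next
      fix \<rho> assume \<rho>: "\<rho> \<in> S - {\<tau>}"
      then have "\<rho> < \<sigma>" using elim(1) by blast
      then show "\<rho> \<in> range T \<inter> {s<..\<sigma>}" using \<rho> by (simp add: S_def)
    qed
    then have n: "n = num_jumps T \<sigma> s"
      using card fin \<open>\<tau> \<in> S\<close> by (simp add: num_jumps_def)
    have "y \<sigma> \<le> exp (- d * real (num_jumps T \<sigma> s) - c * (\<sigma> - s)) * y s"
    proof (rule Suc.hyps(1)[OF n])
      show "s \<le> \<sigma>" using elim by simp
      show "y q \<le> exp (- c * (q - p)) * y p" if "s \<le> p" "p \<le> q" "q \<le> \<sigma>" "range T \<inter> {p<..q} = {}" for p q
        by (rule Suc.prems(2)) (use that elim \<tau> in simp_all)
      show "(y \<longlongrightarrow> l \<rho>) (at_left \<rho>)" if "\<rho> \<in> range T" "s < \<rho>" "\<rho> \<le> \<sigma>" for \<rho>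
        by (rule Suc.prems(3)) (use that elim \<tau> in simp_all)
      show "y \<rho> \<le> exp (- d) * l \<rho>" if "\<rho> \<in> range T" "s < \<rho>" "\<rho> \<le> \<sigma>" for \<rho>
        by (rule Suc.prems(4)) (use that elim \<tau> in simp_all)
    qed
    then show ?case using n by simp
  qed
  moreover have "((\<lambda>\<sigma>. exp (- d * n - c * (\<sigma> - s)) * y s) \<longlongrightarrow> exp (- d * n - c * (\<tau> - s)) * y s) (at_left \<tau>)"
    by (intro tendsto_intros)
  ultimately have "l \<tau> \<le> exp (- d * n - c * (\<tau> - s)) * y s"
    by (intro tendsto_le[OF trivial_limit_at_left_real _ Suc.prems(3)[OF \<tau>]])
  then have y\<tau>: "y \<tau> \<le> exp (- d) * (exp (- d * n - c * (\<tau> - s)) * y s)"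
    by (rule order_trans[OF Suc.prems(4)[OF \<tau>] mult_left_mono[OF _ exp_ge_zero]])
  have "y t \<le> exp (- c * (t - \<tau>)) * y \<tau>"
  proof (rule Suc.prems(2))
    have "\<rho> \<le> \<tau>" if "\<rho> \<in> range T \<inter> {\<tau><..t}" for \<rho>
      using max[of \<rho>] \<tau>(2) that by (simp add: S_def)
    then show "range T \<inter> {\<tau><..t} = {}" by (meson Int_iff disjoint_iff greaterThanAtMost_iff not_le)
  qed (use \<tau> in auto)
  also have "\<dots> \<le> exp (- c * (t - \<tau>)) * (exp (- d) * (exp (- d * n - c * (\<tau> - s)) * y s))"
    by (rule mult_left_mono[OF y\<tau> exp_ge_zero])
  also have "\<dots> = exp (- d * num_jumps T t s - c * (t - s)) * y s"
    by (simp add: Suc.hyps(2)[symmetric] mult_exp_exp algebra_simps flip: mult.assoc)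
  finally show ?case .
qed

text \<open>The supremum of the times with \<open>y \<tau> \<le> X\<close> need not be attained,
  because \<open>y\<close> may jump upwards there. In that case such times accumulate at it from the
  left, so the left limit is at most \<open>X\<close> and \<open>entry\<close> applies.\<close>

lemma last_entry_time:
  fixes y :: "real \<Rightarrow> real"
  assumes t: "t0 \<le> t"
    and left: "\<And>\<tau>. t0 < \<tau> \<Longrightarrow> \<tau> \<le> t \<Longrightarrow> (y \<longlongrightarrow> l \<tau>) (at_left \<tau>)"
    and entry: "\<And>\<tau>. t0 < \<tau> \<Longrightarrow> \<tau> \<le> t \<Longrightarrow> l \<tau> \<le> X \<Longrightarrow> y \<tau> \<le> M"
    and "X \<le> M"
  obtains "\<forall>\<tau>\<in>{t0<..t}. X < y \<tau>"
    | s where "t0 \<le> s" "s \<le> t" "y s \<le> M" "\<forall>\<tau>\<in>{s<..t}. X < y \<tau>"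
proof -
  define Q where "Q = {\<tau> \<in> {t0..t}. y \<tau> \<le> X}"
  show thesis
  proof (cases "Q = {}")
    case True
    then show thesis using that(1) by (force simp: Q_def)
  next
    case False
    define s where "s = Sup Q"
    have bdd: "bdd_above Q" by (auto simp: Q_def)
    have s: "t0 \<le> s" "s \<le> t"
    proof -
      obtain q where "q \<in> Q" using False by blast
      then have "t0 \<le> q" "q \<le> s" using cSup_upper[OF _ bdd] by (auto simp: Q_def s_def)
      then show "t0 \<le> s" by simp
      show "s \<le> t" unfolding s_def using False by (intro cSup_least) (auto simp: Q_def)
    qed
    have above: "\<forall>\<tau>\<in>{s<..t}. X < y \<tau>"
    proof
      fix \<tau> assume \<tau>: "\<tau> \<in> {s<..t}"
      then have "\<tau> \<notin> Q" using cSup_upper[OF _ bdd, of \<tau>] by (auto simp: s_def)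
      then show "X < y \<tau>" using \<tau> s by (auto simp: Q_def)
    qed
    have "y s \<le> M"
    proof (cases "s \<in> Q")
      case True
      then show ?thesis using \<open>X \<le> M\<close> by (simp add: Q_def)
    next
      case nQ: False
      \<comment> \<open>If the supremum were \<open>t0\<close>, the nonempty set \<open>Q\<close>
        would be \<open>{t0}\<close> and the supremum attained.\<close>
      have "s \<noteq> t0"
      proof
        assume "s = t0"
        then have "Q \<subseteq> {s}" using cSup_upper[OF _ bdd] by (fastforce simp: Q_def s_def)
        then show False using False nQ by auto
      qed
      then have s0: "t0 < s" using s by simp
      have "l s \<le> X"
      proof (rule ccontr)
        assume "\<not> l s \<le> X"
        then have "eventually (\<lambda>\<sigma>. X < y \<sigma>) (at_left s)"
          using order_tendstoD(1)[OF left[OF s0 s(2)]] by simp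
        then obtain b where b: "b < s" "\<And>\<sigma>. b < \<sigma> \<Longrightarrow> \<sigma> < s \<Longrightarrow> X < y \<sigma>"
          by (auto simp: eventually_at_left_field)
        obtain q where q: "q \<in> Q" "b < q"
          using less_cSup_iff[OF False bdd, of b] b(1) by (auto simp: s_def)
        have "q \<le> s" using cSup_upper[OF q(1) bdd] by (simp add: s_def)
        then have "q < s" using nQ q(1) by (auto simp: less_le)
        then show False using b(2)[of q] q by (auto simp: Q_def)
      qed
      then show ?thesis using entry[OF s0 s(2)] by simp
    qed
    then show thesis using that(2) s above by blast
  qed
qed

text \<open>The worst value \<omega>(r) after a jump is a supremum over \<open>B r\<close>.
  Boundedness of g on bounded sets makes it finite, and continuity of g at the origin makes it tend
  to 0 with r. Majorizing the sum \<omega> + \<rho> yields both required inequalities at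
  once.\<close>

lemma jump_majorant:
  fixes g :: "'a::real_normed_vector \<Rightarrow> 'b::real_normed_vector \<Rightarrow> 'a" and V :: "'a \<Rightarrow> real"
  assumes g_bounded: "\<And>B. bounded B \<Longrightarrow> bounded ((\<lambda>(x, u). g x u) ` B)"
    and g_cont: "isCont (\<lambda>(x, u). g x u) (0, 0)" and g0: "g 0 0 = 0"
    and \<psi>1: "class_K_inf \<psi>1" and \<psi>2: "class_K_inf \<psi>2" and \<rho>: "class_K_inf \<rho>"
    and V: "\<And>x. \<psi>1 (norm x) \<le> V x" "\<And>x. V x \<le> \<psi>2 (norm x)"
  obtains \<gamma> where "class_K_inf \<gamma>" "\<And>r. 0 \<le> r \<Longrightarrow> \<rho> r \<le> \<gamma> r"
    "\<And>r x u. V x \<le> \<rho> r \<Longrightarrow> norm u \<le> r \<Longrightarrow> V (g x u) \<le> \<gamma> r"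
proof -
  note K1 = class_KD[OF class_K_infD(1)[OF \<psi>1]]
  note K2 = class_KD[OF class_K_infD(1)[OF \<psi>2]]
  note KX = class_KD[OF class_K_infD(1)[OF \<rho>]]
  define B where "B r = {(x :: 'a, u :: 'b). V x \<le> \<rho> r \<and> norm u \<le> r}" for r
  define w where "w = (\<lambda>(x, u). V (g x u))"
  define \<omega> where "\<omega> r = Sup (w ` B r)" for r
  have V0: "V 0 = 0" using V(1)[of 0] V(2)[of 0] K1(2) K2(2) by simp
  have Vnn: "0 \<le> V x" for x using V(1)[of x] K1(4)[of "norm x"] by simp
  have norm_less: "norm x < s" if "0 \<le> s" "V x < \<psi>1 s" for x s
    using K1(6)[OF that(1), of "norm x"] V(1)[of x] that(2) by linarith
  have bdd: "bdd_above (w ` B r)" for r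
  proof -
    \<comment> \<open>The added 1 makes the inequality strict, as \<open>norm_less\<close>
      demands.\<close>
    obtain s where s: "s \<ge> 0" "\<rho> r + 1 \<le> \<psi>1 s" using class_K_infD(2)[OF \<psi>1] by blast
    have "B r \<subseteq> cball 0 s \<times> cball 0 r"
    proof
      fix p assume "p \<in> B r"
      then obtain x u where p: "p = (x, u)" "V x \<le> \<rho> r" "norm u \<le> r" by (auto simp: B_def)
      have "norm x < s" using s p(2) by (intro norm_less) simp_all
      then show "p \<in> cball 0 s \<times> cball 0 r" using p by simp
    qed
    then have "bounded (B r)"
      by (rule bounded_subset[OF bounded_Times[OF bounded_cball bounded_cball]])
    then obtain C where C: "C > 0" "\<And>p. p \<in> B r \<Longrightarrow> norm (case p of (x, u) \<Rightarrow> g x u) \<le> C"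
      using g_bounded[of "B r"] unfolding bounded_pos by blast
    have "w p \<le> \<psi>2 C" if "p \<in> B r" for p
    proof -
      obtain x u where p: "p = (x, u)" by (cases p)
      have "norm (g x u) \<le> C" using C(2)[OF that] by (simp add: p)
      then have "\<psi>2 (norm (g x u)) \<le> \<psi>2 C" by (rule K2(6)[OF norm_ge_zero])
      then show ?thesis using V(2)[of "g x u"] by (simp add: w_def p)
    qed
    then show ?thesis by (rule bdd_aboveI2)
  qed
  have mem: "(0, 0) \<in> B r" if "0 \<le> r" for r
    using KX(4)[OF that] that by (simp add: B_def V0)
  have upper: "w p \<le> \<omega> r" if "p \<in> B r" for p r
    unfolding \<omega>_def using that by (intro cSup_upper bdd imageI)
  have w_nonneg: "0 \<le> w p" for p by (cases p) (simp add: w_def Vnn)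
  have \<omega>_nonneg: "0 \<le> \<omega> r" if "0 \<le> r" for r
    using order_trans[OF w_nonneg upper[OF mem[OF that]]] .
  have \<omega>_least: "\<omega> r \<le> C" if "0 \<le> r" "\<And>p. p \<in> B r \<Longrightarrow> w p \<le> C" for r C
    unfolding \<omega>_def using that mem[OF that(1)] by (intro cSUP_least) auto
  have mono: "mono_on {0..} (\<lambda>r. \<omega> r + \<rho> r)"
  proof (intro mono_onI add_mono)
    fix r s :: real assume rs: "r \<in> {0..}" "s \<in> {0..}" "r \<le> s"
    then show "\<rho> r \<le> \<rho> s" by (intro KX(6)) simp_all
    then have sub: "B r \<subseteq> B s" using rs(3) by (auto simp: B_def)
    show "\<omega> r \<le> \<omega> s"
    proof (rule \<omega>_least)
      show "w p \<le> \<omega> s" if "p \<in> B r" for p using that sub by (intro upper) blast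
    qed (use rs in simp)
  qed
  have zero: "\<omega> 0 + \<rho> 0 = 0"
  proof -
    have "w p \<le> 0" if "p \<in> B 0" for p
    proof -
      obtain x u where p: "p = (x, u)" by (cases p)
      have "V x \<le> 0" "u = 0" using that KX(2) by (simp_all add: p B_def)
      moreover have "x = 0"
      proof (rule ccontr)
        assume "x \<noteq> 0"
        then have "0 < \<psi>1 (norm x)" by (intro K1(3)) simp
        then show False using V(1)[of x] \<open>V x \<le> 0\<close> by linarith
      qed
      ultimately show ?thesis by (simp add: p w_def g0 V0)
    qed
    then have "\<omega> 0 \<le> 0" by (intro \<omega>_least) simp_all
    then show ?thesis using \<omega>_nonneg[of 0] KX(2) by simp
  qed
  have \<rho>_lim: "(\<rho> \<longlongrightarrow> 0) (at_right 0)"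
    using KX(1,2) by (metis atLeast_iff at_within_Ici_at_right continuous_on_def order_refl)
  have "(\<omega> \<longlongrightarrow> 0) (at_right 0)"
  proof (rule tendstoI)
    fix e :: real assume e: "0 < e"
    \<comment> \<open>Passing to the supremum only preserves weak inequalities, so the target is
      \<open>e / 2\<close>.\<close>
    obtain \<eta> where \<eta>: "\<eta> \<ge> 0" "\<psi>2 \<eta> = e / 2"
      using class_K_inf_surj[OF \<psi>2, of "e / 2"] e by auto
    have "\<eta> > 0" using \<eta> K2(2) e by (cases "\<eta> = 0") auto
    then obtain \<delta> where \<delta>: "\<delta> > 0" "\<And>p. dist p (0, 0) < \<delta> \<Longrightarrow> dist (case p of (x, u) \<Rightarrow> g x u) (g 0 0) < \<eta>"
      using g_cont unfolding continuous_at_eps_delta by (metis case_prod_conv)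
    have "eventually (\<lambda>r. \<rho> r < \<psi>1 (\<delta> / 2)) (at_right 0)"
      using order_tendstoD(2)[OF \<rho>_lim] K1(3)[of "\<delta> / 2"] \<delta>(1) by simp
    moreover have "eventually (\<lambda>r. r \<in> {0<..<\<delta> / 2}) (at_right 0)"
      by (rule eventually_at_right_real) (use \<delta>(1) in simp)
    ultimately show "eventually (\<lambda>r. dist (\<omega> r) 0 < e) (at_right 0)"
    proof eventually_elim
      case (elim r)
      have "w p \<le> e / 2" if "p \<in> B r" for p
      proof -
        obtain x u where p: "p = (x, u)" by (cases p)
        have xu: "V x \<le> \<rho> r" "norm u \<le> r" using that by (simp_all add: p B_def)
        have "norm x < \<delta> / 2" using xu(1) elim(1) \<delta>(1) by (intro norm_less) simp_all
        moreover have "norm u < \<delta> / 2" using xu(2) elim(2) by simp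
        ultimately have "norm (x, u) < \<delta>"
          using norm_Pair_le[of x u] by linarith
        then have "norm (g x u) \<le> \<eta>"
          using \<delta>(2)[of "(x, u)"] by (simp add: dist_norm g0 flip: zero_prod_def)
        then have "\<psi>2 (norm (g x u)) \<le> \<psi>2 \<eta>" by (rule K2(6)[OF norm_ge_zero])
        then show ?thesis using V(2)[of "g x u"] \<eta>(2) by (simp add: w_def p)
      qed
      moreover have "0 \<le> r" using elim(2) by simp
      ultimately have "\<omega> r \<le> e / 2" by (intro \<omega>_least)
      then show ?case using \<omega>_nonneg[of r] elim(2) e by simp
    qed
  qed
  from tendsto_add[OF this \<rho>_lim] have "((\<lambda>r. \<omega> r + \<rho> r) \<longlongrightarrow> 0) (at_right 0)" by simp
  then obtain \<gamma> where \<gamma>: "class_K_inf \<gamma>" "\<And>r. 0 \<le> r \<Longrightarrow> \<omega> r + \<rho> r \<le> \<gamma> r"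
    using mono_class_K_inf_majorant[OF mono zero] by blast
  show thesis
  proof (rule that[OF \<gamma>(1)])
    show "\<rho> r \<le> \<gamma> r" if "0 \<le> r" for r using \<gamma>(2)[OF that] \<omega>_nonneg[OF that] by linarith
    show "V (g x u) \<le> \<gamma> r" if "V x \<le> \<rho> r" "norm u \<le> r" for r x u
    proof -
      have "0 \<le> r" using that(2) norm_ge_zero order_trans by blast
      have "V (g x u) \<le> \<omega> r" using upper[of "(x, u)" r] that by (simp add: B_def w_def)
      then show ?thesis using \<gamma>(2)[OF \<open>0 \<le> r\<close>] KX(4)[OF \<open>0 \<le> r\<close>] by linarith
    qed
  qed
qed

section \<open>Left limits of inputs and solutions, and the estimate along a trajectory\<close>

lemma norm_le_sup_norm:
  assumes "admissible_input t0 u" "t0 \<le> t"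
  shows "norm (u t) \<le> sup_norm t0 u"
proof -
  obtain b where "\<And>s. t0 \<le> s \<Longrightarrow> norm (u s) \<le> b"
    using assms(1) unfolding admissible_input_def bounded_iff by blast
  then have "bdd_above ((\<lambda>t. norm (u t)) ` {t0..})" by (intro bdd_aboveI2) simp
  then show ?thesis
    unfolding sup_norm_def using assms(2) by (intro cSUP_upper) simp_all
qed

lemma norm_left_limit_le_sup_norm:
  assumes "admissible_input t0 u" "t0 < t"
  shows "norm (Lim (at_left t) u) \<le> sup_norm t0 u"
proof -
  obtain l where l: "(u \<longlongrightarrow> l) (at_left t)"
    using assms unfolding admissible_input_def by blast
  have "eventually (\<lambda>s. norm (u s) \<le> sup_norm t0 u) (at_left t)"
    using eventually_at_left_real[OF assms(2)]
    by eventually_elim (use norm_le_sup_norm[OF assms(1)] in simp)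
  then have "norm l \<le> sup_norm t0 u"
    using tendsto_upperbound[OF tendsto_norm[OF l]] by simp
  moreover have "Lim (at_left t) u = l"
    using l by (intro tendsto_Lim) simp_all
  ultimately show ?thesis by simp
qed

text \<open>Impulse times do not accumulate, so some interval [a, t] has no impulse in (a, t].
  Absolute continuity on it gives continuity from the left.\<close>

lemma solution_left_continuous:
  assumes imp: "impulse_times t0 T" and sol: "is_solution f g t0 T u x0 J x"
    and J: "{t0..t} \<subseteq> J" and t: "t0 < t" "t \<notin> range T"
  shows "(x \<longlongrightarrow> x t) (at_left t)"
proof -
  have "\<not> t islimpt range T" using imp by (simp add: impulse_times_def)
  then obtain e where e: "e > 0" "\<And>s. s \<in> range T \<Longrightarrow> s \<noteq> t \<Longrightarrow> e \<le> dist s t"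
    unfolding islimpt_approachable by (meson not_le)
  define a where "a = max t0 (t - e / 2)"
  have a: "t0 \<le> a" "a < t" "t - e < a" using e(1) t(1) by (auto simp: a_def)
  have "range T \<inter> {a<..t} = {}"
  proof (rule ccontr)
    assume "range T \<inter> {a<..t} \<noteq> {}"
    then obtain s where s: "s \<in> range T" "s \<in> {a<..t}" by blast
    then have "e \<le> dist s t" using e(2)[of s] t(2) by metis
    then show False using s(2) a by (simp add: dist_real_def)
  qed
  moreover have "{a..t} \<subseteq> J" using J a(1) by auto
  ultimately have "abs_continuous_on {a..t} x"
    using sol a(2) unfolding is_solution_def by (meson less_imp_le)
  then show ?thesis
    using continuous_on_Icc_at_leftD[OF abs_continuous_on_imp_continuous_on a(2)] by blast
qed

text \<open>Let \<open>s\<close> be the last time at which \<open>V \<le> \<rho> (\<parallel>u\<parallel>)\<close>, or \<open>t0\<close> if there is none. After \<open>s\<close> the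
  dissipation inequalities hold, and \<open>V (x s) \<le> M\<close> even if the trajectory leaves the sublevel
  set by a jump at \<open>s\<close>.\<close>

lemma trajectory_estimate:
  fixes f g :: "real ^ 'n \<Rightarrow> real ^ 'm \<Rightarrow> real ^ 'n" and V :: "real ^ 'n \<Rightarrow> real"
  assumes imp: "impulse_times t0 T" and adm: "admissible_input t0 u"
    and sol: "is_solution f g t0 T u x0 J x" and J: "{t0..t} \<subseteq> J" and t: "t0 \<le> t"
    and G: "\<And>p. GDERIV V p :> G p" and cont: "continuous_on UNIV G"
    and \<rho>: "class_K \<rho>"
    and diss: "\<And>p v. \<rho> (norm v) \<le> V p \<Longrightarrow> G p \<bullet> f p v \<le> - c * V p \<and> V (g p v) \<le> exp (- d) * V p"
    and M: "\<rho> (sup_norm t0 u) \<le> M"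
      "\<And>p v. V p \<le> \<rho> (sup_norm t0 u) \<Longrightarrow> norm v \<le> sup_norm t0 u \<Longrightarrow> V (g p v) \<le> M"
  shows "V (x t) \<le> exp (- d * num_jumps T t t0 - c * (t - t0)) * V x0 \<or>
    (\<exists>s\<in>{t0..t}. V (x t) \<le> exp (- d * num_jumps T t s - c * (t - s)) * M)"
proof -
  define X where "X = \<rho> (sup_norm t0 u)"
  define y where "y \<tau> = V (x \<tau>)" for \<tau>
  define l where "l \<tau> = V (Lim (at_left \<tau>) x)" for \<tau>
  \<comment> \<open>Monotonicity of \<rho> replaces the threshold for the current input value by the
    single threshold \<open>X\<close>.\<close>
  have diss_X: "G p \<bullet> f p v \<le> - c * V p" "V (g p v) \<le> exp (- d) * V p"
    if "X \<le> V p" "norm v \<le> sup_norm t0 u" for p v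
    using diss[of v p] class_KD(6)[OF \<rho> norm_ge_zero that(2)] that(1) unfolding X_def by auto
  have V_cont: "isCont V p" for p
    using G[of p] unfolding gderiv_def by (rule has_derivative_continuous)
  have left: "(y \<longlongrightarrow> l \<tau>) (at_left \<tau>)" if \<tau>: "t0 < \<tau>" "\<tau> \<le> t" for \<tau>
  proof -
    have "\<tau> \<in> J" using J \<tau> by auto
    then obtain q where q: "(x \<longlongrightarrow> q) (at_left \<tau>)"
      using sol \<tau>(1) unfolding is_solution_def by blast
    then have "Lim (at_left \<tau>) x = q" by (intro tendsto_Lim) simp_all
    then show ?thesis
      unfolding y_def l_def using isCont_tendsto_compose[OF V_cont q] by simp
  qed
  have jump_eq: "x \<tau> = g (Lim (at_left \<tau>) x) (Lim (at_left \<tau>) u)" if "\<tau> \<in> range T" "\<tau> \<le> t" for \<tau>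
  proof -
    have "t0 < \<tau>" using that(1) imp by (auto simp: impulse_times_def)
    then have "\<tau> \<in> J \<inter> range T" using that J by (simp add: subset_iff)
    then show ?thesis using sol unfolding is_solution_def by blast
  qed
  have entry: "y \<tau> \<le> M" if \<tau>: "t0 < \<tau>" "\<tau> \<le> t" "l \<tau> \<le> X" for \<tau>
  proof (cases "\<tau> \<in> range T")
    case True
    have "V (g (Lim (at_left \<tau>) x) (Lim (at_left \<tau>) u)) \<le> M"
      using \<tau>(3) norm_left_limit_le_sup_norm[OF adm \<tau>(1)] unfolding l_def X_def by (rule M(2))
    then show ?thesis unfolding y_def using jump_eq[OF True \<tau>(2)] by simp
  next
    \<comment> \<open>Off the impulse times \<open>y\<close> is left continuous, so its value equals
      its left limit and is at most \<open>X\<close>.\<close>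
    case False
    have "{t0..\<tau>} \<subseteq> J" using J \<tau>(2) by auto
    then have "(x \<longlongrightarrow> x \<tau>) (at_left \<tau>)"
      by (rule solution_left_continuous[OF imp sol _ \<tau>(1) False])
    then have "(y \<longlongrightarrow> y \<tau>) (at_left \<tau>)"
      unfolding y_def by (rule isCont_tendsto_compose[OF V_cont])
    then have "y \<tau> = l \<tau>"
      by (rule tendsto_unique[OF trivial_limit_at_left_real _ left[OF \<tau>(1,2)]])
    then show ?thesis using \<tau>(3) M(1) by (simp add: X_def)
  qed
  have decay: "y t \<le> exp (- d * num_jumps T t s - c * (t - s)) * y s"
    if s: "t0 \<le> s" "s \<le> t" and above: "\<forall>\<tau>\<in>{s<..t}. X < y \<tau>" for s
  proof (rule impulsive_decay[OF imp _ _ _ s(2)])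
    fix p q assume pq: "s \<le> p" "p \<le> q" "q \<le> t" "range T \<inter> {p<..q} = {}"
    show "y q \<le> exp (- c * (q - p)) * y p"
      unfolding y_def
    proof (rule lyapunov_flow_decay[OF G cont _ pq(2)])
      have "{p..q} \<subseteq> J" using J s(1) pq by auto
      then show "abs_continuous_on {p..q} x"
        using sol pq(2,4) unfolding is_solution_def by blast
      have "AE \<tau> in lebesgue. \<tau> \<in> J - range T \<longrightarrow> (x has_vector_derivative f (x \<tau>) (u \<tau>)) (at \<tau>)"
        using sol unfolding is_solution_def by blast
      then show "AE \<tau> in lebesgue. p < \<tau> \<and> \<tau> < q \<longrightarrow>
          (\<exists>v. (x has_vector_derivative v) (at \<tau>) \<and> G (x \<tau>) \<bullet> v \<le> - c * V (x \<tau>))"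
      proof (rule AE_mp, intro AE_I2 impI)
        fix \<tau> assume dx: "\<tau> \<in> J - range T \<longrightarrow> (x has_vector_derivative f (x \<tau>) (u \<tau>)) (at \<tau>)"
          and \<tau>: "p < \<tau> \<and> \<tau> < q"
        \<comment> \<open>Only interior times are treated: at \<open>p = s\<close> itself the bound
          \<open>X < y p\<close> may fail.\<close>
        have "\<tau> \<in> {p<..q}" "\<tau> \<in> {p..q}" "\<tau> \<in> {s<..t}" using \<tau> pq(1,3) by simp_all
        then have "\<tau> \<in> J - range T" using pq(4) \<open>{p..q} \<subseteq> J\<close> by blast
        moreover have "X \<le> V (x \<tau>)"
          using bspec[OF above \<open>\<tau> \<in> {s<..t}\<close>] unfolding y_def by simp
        moreover have "norm (u \<tau>) \<le> sup_norm t0 u"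
          using \<tau> pq(1) s(1) by (intro norm_le_sup_norm[OF adm]) simp
        ultimately show "\<exists>v. (x has_vector_derivative v) (at \<tau>) \<and> G (x \<tau>) \<bullet> v \<le> - c * V (x \<tau>)"
          using dx diss_X(1) by blast
      qed
    qed
  next
    fix \<tau> assume \<tau>: "\<tau> \<in> range T" "s < \<tau>" "\<tau> \<le> t"
    then have t0\<tau>: "t0 < \<tau>" using s by simp
    show "(y \<longlongrightarrow> l \<tau>) (at_left \<tau>)" by (rule left[OF t0\<tau> \<tau>(3)])
    \<comment> \<open>The jump inequality concerns the state just before the impulse, so the lower
      bound has to be carried over to the left limit.\<close>
    then have "X \<le> l \<tau>"
    proof (rule tendsto_lowerbound)
      show "eventually (\<lambda>\<sigma>. X \<le> y \<sigma>) (at_left \<tau>)"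
        using eventually_at_left_real[OF \<tau>(2)]
      proof eventually_elim
        case (elim \<sigma>)
        then have "\<sigma> \<in> {s<..t}" using \<tau>(3) by simp
        then show ?case using above less_imp_le by blast
      qed
    qed simp
    then show "y \<tau> \<le> exp (- d) * l \<tau>"
      unfolding y_def l_def jump_eq[OF \<tau>(1,3)]
      by (rule diss_X(2)) (rule norm_left_limit_le_sup_norm[OF adm t0\<tau>])
  qed
  have "x t0 = x0" using sol by (simp add: is_solution_def)
  have "X \<le> M" using M(1) by (simp add: X_def)
  show ?thesis
  proof (rule last_entry_time[of t0 t y l X M, OF t left entry \<open>X \<le> M\<close>])
    assume "\<forall>\<tau>\<in>{t0<..t}. X < y \<tau>"
    from decay[OF order_refl t this] show ?thesis
      unfolding y_def \<open>x t0 = x0\<close> by blast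
  next
    fix s assume s: "t0 \<le> s" "s \<le> t" "y s \<le> M" "\<forall>\<tau>\<in>{s<..t}. X < y \<tau>"
    note decay[OF s(1,2,4)]
    also have "exp (- d * num_jumps T t s - c * (t - s)) * y s \<le> exp (- d * num_jumps T t s - c * (t - s)) * M"
      by (rule mult_left_mono[OF s(3) exp_ge_zero])
    finally have "V (x t) \<le> exp (- d * num_jumps T t s - c * (t - s)) * M" unfolding y_def .
    moreover have "s \<in> {t0..t}" using s(1,2) by simp
    ultimately show ?thesis by blast
  qed
qed

section \<open>Assembling the comparison functions\<close>

lemma class_L_mono:
  assumes "class_L l" "0 \<le> s" "s \<le> t"
  shows "l t \<le> l s"
  using assms monotone_onD[of "{0..}" "(<)" "(>)" l s t]
  unfolding class_L_def by (cases "s = t") auto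

theorem theorem2:
  fixes f g :: "real ^ 'n \<Rightarrow> real ^ 'm \<Rightarrow> real ^ 'n"
    and V :: "real ^ 'n \<Rightarrow> real"
    and c d t0 :: real
    and h :: "real \<Rightarrow> real"
  assumes "locally_lipschitz_fst f"
    and "f 0 0 = 0" and "g 0 0 = 0"
    and g_bounded: "\<And>B. bounded B \<Longrightarrow> bounded ((\<lambda>(x, u). g x u) ` B)"
    and g_continuous_0: "isCont (\<lambda>(x, u). g x u) (0, 0)"
    and "exp_ISS_Lyapunov f g V c d"
    and "d \<noteq> 0"
    and "\<forall>r\<ge>0. 0 < h r"
    and "\<exists>l. class_L l \<and> (\<forall>r\<ge>0. h r \<le> l r)"
  shows "uniformly_ISS f g t0 (gADT_class t0 c d h)"
proof -
  obtain l where l: "class_L l" "\<And>r. 0 \<le> r \<Longrightarrow> h r \<le> l r" using assms(9) by blast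
  have l_pos: "0 < l r" if "0 \<le> r" for r using assms(8) l(2)[OF that] that by force
  have "smooth V" and "\<And>x. 0 \<le> V x" using assms(6) by (auto simp: exp_ISS_Lyapunov_def)
  note G = smooth_gradient[OF \<open>smooth V\<close>]
  obtain \<psi>1 \<psi>2 where \<psi>: "class_K_inf \<psi>1" "class_K_inf \<psi>2"
      "\<And>x. \<psi>1 (norm x) \<le> V x" "\<And>x. V x \<le> \<psi>2 (norm x)"
    using assms(6) unfolding exp_ISS_Lyapunov_def by blast
  obtain \<rho> where \<rho>: "class_K_inf \<rho>" and
    diss: "\<And>x u. \<rho> (norm u) \<le> V x \<Longrightarrow> gradient V x \<bullet> f x u \<le> - c * V x \<and> V (g x u) \<le> exp (- d) * V x"
    using assms(6) unfolding exp_ISS_Lyapunov_def by blast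
  obtain \<mu> where \<mu>: "class_K_inf \<mu>" "\<And>r. 0 \<le> r \<Longrightarrow> \<rho> r \<le> \<mu> r"
    "\<And>r x u. V x \<le> \<rho> r \<Longrightarrow> norm u \<le> r \<Longrightarrow> V (g x u) \<le> \<mu> r"
    using jump_majorant[OF g_bounded g_continuous_0 assms(3) \<psi>(1,2) \<rho> \<psi>(3,4)] by blast
  obtain \<alpha> where \<alpha>: "class_K_inf \<alpha>" "\<And>r y. 0 \<le> r \<Longrightarrow> \<psi>1 r \<le> y \<Longrightarrow> r \<le> \<alpha> y"
    using class_K_inf_inverse[OF \<psi>(1)] by blast
  \<comment> \<open>In \<gamma> the factor is \<open>l 0\<close>: the time elapsed since the last
    entry is not controlled, and \<open>l (t - s)\<close> is at most \<open>l 0\<close>.\<close>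
  define \<beta> where "\<beta> r t = \<alpha> (l t * \<psi>2 r)" for r t
  define \<gamma> where "\<gamma> r = \<alpha> (l 0 * \<mu> r)" for r
  have "class_KL \<beta>"
    unfolding \<beta>_def by (rule class_KL_compose[OF \<alpha>(1) class_K_infD(1)[OF \<psi>(2)] l(1) l_pos])
  moreover have "class_K_inf \<gamma>"
    unfolding \<gamma>_def by (rule class_K_inf_compose[OF \<alpha>(1) \<mu>(1) l_pos[OF order_refl]])
  moreover have "ISS_estimate f g t0 T \<beta> \<gamma>" if T: "T \<in> gADT_class t0 c d h" for T
    unfolding ISS_estimate_def
  proof (intro allI impI ballI)
    fix x0 u J x t
    assume A: "admissible_input t0 u \<and> (J = {t0..} \<or> (\<exists>\<tau>>t0. J = {t0..<\<tau>})) \<and> is_solution f g t0 T u x0 J x"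
      and "t \<in> J"
    then have adm: "admissible_input t0 u" and sol: "is_solution f g t0 T u x0 J x"
      and t: "t0 \<le> t" and J: "{t0..t} \<subseteq> J" by auto
    have imp: "impulse_times t0 T" using T by (simp add: gADT_class_def)
    \<comment> \<open>The bound by \<open>l\<close> no longer mentions \<open>T\<close>, which makes
      the estimate uniform over the class.\<close>
    have adt: "exp (- d * num_jumps T t s - c * (t - s)) \<le> l (t - s)" if "s \<in> {t0..t}" for s
    proof -
      have "- d * num_jumps T t s - c * (t - s) \<le> ln (h (t - s))"
        using T that by (simp add: gADT_class_def)
      moreover have "0 < h (t - s)" using assms(8) that by simp
      ultimately have "exp (- d * num_jumps T t s - c * (t - s)) \<le> h (t - s)"
        using ln_ge_iff by blast
      then show ?thesis using l(2)[of "t - s"] that by simp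
    qed
    define r where "r = sup_norm t0 u"
    have "0 \<le> r"
      using norm_le_sup_norm[OF adm order_refl] norm_ge_zero[of "u t0"] unfolding r_def by linarith
    have nn: "0 \<le> \<psi>2 (norm x0)" "0 \<le> \<mu> r"
      using class_KD(4)[OF class_K_infD(1)] \<psi>(2) \<mu>(1) \<open>0 \<le> r\<close> by simp_all
    have "V (x t) \<le> l (t - t0) * \<psi>2 (norm x0) \<or> V (x t) \<le> l 0 * \<mu> r"
    proof -
      have "V (x t) \<le> exp (- d * num_jumps T t t0 - c * (t - t0)) * V x0 \<or>
          (\<exists>s\<in>{t0..t}. V (x t) \<le> exp (- d * num_jumps T t s - c * (t - s)) * \<mu> r)"
      proof (rule trajectory_estimate[where G = "gradient V" and \<rho> = \<rho> and f = f and g = g,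
            OF imp adm sol J t G class_K_infD(1)[OF \<rho>]])
        show "gradient V p \<bullet> f p v \<le> - c * V p \<and> V (g p v) \<le> exp (- d) * V p"
          if "\<rho> (norm v) \<le> V p" for p v using that by (rule diss)
        show "\<rho> (sup_norm t0 u) \<le> \<mu> r" using \<mu>(2)[OF \<open>0 \<le> r\<close>] by (simp add: r_def)
        show "V (g p v) \<le> \<mu> r" if "V p \<le> \<rho> (sup_norm t0 u)" "norm v \<le> sup_norm t0 u" for p v
          using that unfolding r_def by (rule \<mu>(3))
      qed
      then show ?thesis
      proof (elim disjE bexE)
        assume "V (x t) \<le> exp (- d * num_jumps T t t0 - c * (t - t0)) * V x0"
        also have "\<dots> \<le> l (t - t0) * \<psi>2 (norm x0)"
          using adt[of t0] t l_pos[of "t - t0"] \<psi>(4)[of x0] \<open>\<And>x. 0 \<le> V x\<close>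
          by (intro mult_mono) simp_all
        finally show ?thesis ..
      next
        fix s assume s: "s \<in> {t0..t}" "V (x t) \<le> exp (- d * num_jumps T t s - c * (t - s)) * \<mu> r"
        note s(2)
        also have "exp (- d * num_jumps T t s - c * (t - s)) * \<mu> r \<le> l 0 * \<mu> r"
          using order_trans[OF adt[OF s(1)] class_L_mono[OF l(1), of 0 "t - s"]] s(1) nn(2)
          by (intro mult_right_mono) simp_all
        finally show ?thesis ..
      qed
    qed
    then have "norm (x t) \<le> \<beta> (norm x0) (t - t0) \<or> norm (x t) \<le> \<gamma> r"
      unfolding \<beta>_def \<gamma>_def
      by (elim disj_forward) (rule \<alpha>(2)[OF norm_ge_zero order_trans[OF \<psi>(3)]], assumption)+
    then show "norm (x t) \<le> max (\<beta> (norm x0) (t - t0)) (\<gamma> (sup_norm t0 u))"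
      by (auto simp: r_def)
  qed
  ultimately show ?thesis unfolding uniformly_ISS_def by blast
qed

end
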